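(* Let $N\ge1$. For any $k\ge1$ and any $d\in\mathbb{N}$, there is a natural isomorphism of vector spaces $$H^0\big(\mathbb{P}^N,E_{k,\infty}\mathbb{P}^N(d)\big)\simeq (V_d^{\mathrm{diff}})^{(k)}.$$
   Context: Differential polynomials: $V=\mathbb{C}[X_i^{(k)} : 0\le i\le N,\ k\in\mathbb{N}]$, with $X^{(k)}=(X_0^{(k)},\dots,X_N^{(k)})$. For $Q\in\mathbb{C}[T]$ put $(QX)^{(k)}=\sum_{i=0}^{k}\binom{k}{i}Q^{(k-i)}X^{(i)}$ and, for $P\in V$, $Q\cdot P=P\big((QX)^{(0)},(QX)^{(1)},\dots\big)\in V[T]$. $P$ is differentially homogeneous of degree $d$ if $Q\cdot P=Q^dP$ for all $Q\in\mathbb{C}[T]$. $(V_d^{\mathrm{diff}})^{(k)}$ is the complex vector space of differentially homogeneous polynomials of degree $d$ lying in $\mathbb{C}[X^{(0)},\dots,X^{(k)}]$. Green--Griffiths bundles: let $M$ be a complex manifold of dimension $N$ and $k\ge1$. $J_kM\to M$ is the bundle of $k$-jets $\mathrm{d}_k\gamma$ at $0$ of holomorphic germs $\gamma:(\mathbb{C},0)\to M$; in a chart $\varphi$ the fiber coordinates are $\big((\varphi\circ\gamma)^{(i)}(0)\big)_{1\le i\le k}$, and $\lambda\in\mathbb{C}^*$ acts by multiplying the $i$-th component by $\lambda^i$. For $n\ge1$, $E_{k,n}M$ is the vector bundle whose fiber over $x$ is the space of complex-valued polynomials $Q$ on $(J_kM)_x$ with $Q(\lambda\cdot\mathrm{d}_k\gamma)=\lambda^nQ(\mathrm{d}_k\gamma)$;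 by convention $E_{k,0}M=\mathcal{O}_M$. Put $E_{k,\infty}M=\bigoplus_{n\ge0}E_{k,n}M$ and $E_{k,\infty}\mathbb{P}^N(d)=E_{k,\infty}\mathbb{P}^N\otimes\mathcal{O}_{\mathbb{P}^N}(d)$. *)

theory Defs
  imports
    "HOL-Analysis.Analysis"
    "HOL-Library.Poly_Mapping"
    "HOL-Library.Function_Algebras"
    "HOL-Computational_Algebra.Polynomial"
begin

section \<open>Complex polynomials in an arbitrary set of variables\<close>

text \<open>The ring \<open>\<complex>[v : v \<in> 'v]\<close> is the monoid algebra of the finitely supported exponent
  functions; its ring operations are those of \<^theory>\<open>HOL-Library.Poly_Mapping\<close>.\<close>

type_synonym 'v cpoly = "('v \<Rightarrow>\<^sub>0 nat) \<Rightarrow>\<^sub>0 complex"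

definition cpoly_const :: "complex \<Rightarrow> 'v cpoly" where
  "cpoly_const c = Poly_Mapping.single 0 c"

definition cpoly_var :: "'v \<Rightarrow> 'v cpoly" where
  "cpoly_var v = Poly_Mapping.single (Poly_Mapping.single v 1) 1"

definition cpoly_scale :: "complex \<Rightarrow> 'v cpoly \<Rightarrow> 'v cpoly" where
  "cpoly_scale c P = cpoly_const c * P"

definition cpoly_vars :: "'v cpoly \<Rightarrow> 'v set" where
  "cpoly_vars P = (\<Union>m\<in>Poly_Mapping.keys P. Poly_Mapping.keys m)"

text \<open>Substitution of \<open>g v\<close> for each variable \<open>v\<close>, the coefficients being mapped
  into the target ring by \<open>h\<close>.\<close>

definition cpoly_subst :: "(complex \<Rightarrow> 'b::comm_ring_1) \<Rightarrow> ('v \<Rightarrow> 'b) \<Rightarrow> 'v cpoly \<Rightarrow> 'b" where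
  "cpoly_subst h g P =
     (\<Sum>m\<in>Poly_Mapping.keys P. h (Poly_Mapping.lookup P m) *
        (\<Prod>v\<in>Poly_Mapping.keys m. g v ^ Poly_Mapping.lookup m v))"

definition cpoly_eval :: "('v \<Rightarrow> complex) \<Rightarrow> 'v cpoly \<Rightarrow> complex" where
  "cpoly_eval = cpoly_subst (\<lambda>c. c)"


section \<open>Differentially homogeneous polynomials\<close>

text \<open>The variable \<open>X\<^sub>i\<close> with derivation order \<open>m\<close> is the pair \<open>(i, m)\<close>; the index type \<open>'i\<close>
  plays the role of \<open>{0, \<dots>, N}\<close>. The ring \<open>V[T]\<close> is \<open>'i diffpoly poly\<close>.\<close>

type_synonym 'i diffpoly = "('i \<times> nat) cpoly"

definition QX :: "complex poly \<Rightarrow> 'i \<Rightarrow> nat \<Rightarrow> 'i diffpoly poly" where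
  "QX Q i m = (\<Sum>l\<le>m. of_nat (m choose l) *
     map_poly cpoly_const ((pderiv ^^ (m - l)) Q) * [:cpoly_var (i, l):])"

definition diff_act :: "complex poly \<Rightarrow> 'i diffpoly \<Rightarrow> 'i diffpoly poly" where
  "diff_act Q P = cpoly_subst (\<lambda>c. [:cpoly_const c:]) (\<lambda>(i, m). QX Q i m) P"

definition diff_homogeneous :: "nat \<Rightarrow> 'i diffpoly \<Rightarrow> bool" where
  "diff_homogeneous d P \<longleftrightarrow>
     (\<forall>Q. diff_act Q P = (map_poly cpoly_const Q) ^ d * [:P:])"

definition V_diff :: "nat \<Rightarrow> nat \<Rightarrow> 'i diffpoly set" where
  "V_diff d k = {P. diff_homogeneous d P \<and> cpoly_vars P \<subseteq> UNIV \<times> {..k}}"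


section \<open>Jets and Green--Griffiths bundles of a manifold given by an atlas\<close>

text \<open>A manifold modelled on \<open>\<complex>\<^sup>N\<close>, \<open>N = CARD('n)\<close>, is a type \<open>'p\<close> of points with a set of charts
  \<open>(U, \<phi>)\<close> whose domains cover \<open>'p\<close>. A germ \<open>(\<complex>,0) \<rightarrow> M\<close> is represented by a total function;
  its values away from \<open>0\<close> do not matter.\<close>

type_synonym ('p, 'n) chart = "'p set \<times> ('p \<Rightarrow> (complex, 'n) vec)"
type_synonym 'p jet = "(complex \<Rightarrow> 'p) set"

definition holomorphic_mv :: "((complex, 'n::finite) vec \<Rightarrow> complex) \<Rightarrow> (complex, 'n) vec set \<Rightarrow> bool"
  where
  "holomorphic_mv f S \<longleftrightarrow>
     (\<forall>z\<in>S. \<exists>D. (f has_derivative D) (at z) \<and> (\<forall>c w. D (c *s w) = c * D w))"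

definition curve_holomorphic_at_0 :: "(complex \<Rightarrow> (complex, 'm::finite) vec) \<Rightarrow> bool" where
  "curve_holomorphic_at_0 g \<longleftrightarrow> (\<forall>j. (\<lambda>z. g z $ j) analytic_on {0})"

definition deriv_coord :: "(complex \<Rightarrow> (complex, 'm::finite) vec) \<Rightarrow> 'm \<times> nat \<Rightarrow> complex" where
  "deriv_coord g = (\<lambda>(j, i). (deriv ^^ i) (\<lambda>z. g z $ j) 0)"

definition hol_germ :: "('p, 'n::finite) chart set \<Rightarrow> (complex \<Rightarrow> 'p) \<Rightarrow> bool" where
  "hol_germ A \<gamma> \<longleftrightarrow>
     (\<forall>(U, \<phi>)\<in>A. \<gamma> 0 \<in> U \<longrightarrow>
        (\<forall>\<^sub>F z in nhds 0. \<gamma> z \<in> U) \<and> curve_holomorphic_at_0 (\<phi> \<circ> \<gamma>))"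

definition jet :: "('p, 'n::finite) chart set \<Rightarrow> nat \<Rightarrow> (complex \<Rightarrow> 'p) \<Rightarrow> 'p jet" where
  "jet A k \<gamma> = {\<delta>. hol_germ A \<delta> \<and> \<delta> 0 = \<gamma> 0 \<and>
     (\<forall>(U, \<phi>)\<in>A. \<gamma> 0 \<in> U \<longrightarrow>
        (\<forall>j. \<forall>i\<in>{1..k}. deriv_coord (\<phi> \<circ> \<delta>) (j, i) = deriv_coord (\<phi> \<circ> \<gamma>) (j, i)))}"

definition jets_at :: "('p, 'n::finite) chart set \<Rightarrow> nat \<Rightarrow> 'p \<Rightarrow> 'p jet set" where
  "jets_at A k x = {jet A k \<gamma> | \<gamma>. hol_germ A \<gamma> \<and> \<gamma> 0 = x}"

definition jet_scale :: "('p, 'n::finite) chart set \<Rightarrow> nat \<Rightarrow> complex \<Rightarrow> 'p jet \<Rightarrow> 'p jet" where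
  "jet_scale A k c J = {\<delta>. hol_germ A \<delta> \<and> (\<exists>\<gamma>\<in>J. \<delta> 0 = \<gamma> 0 \<and>
     (\<forall>(U, \<phi>)\<in>A. \<gamma> 0 \<in> U \<longrightarrow>
        (\<forall>j. \<forall>i\<in>{1..k}. deriv_coord (\<phi> \<circ> \<delta>) (j, i) = c ^ i * deriv_coord (\<phi> \<circ> \<gamma>) (j, i))))}"

text \<open>The fiber of \<open>E\<^bsub>k,n\<^esub>M\<close> over \<open>x\<close>. Functions on \<open>(J\<^sub>kM)\<^sub>x\<close> are extended by \<open>0\<close> to all sets of
  germs. For \<open>n = 0\<close> the formula yields the constants, in accordance with \<open>E\<^bsub>k,0\<^esub>M = \<O>\<^sub>M\<close>.\<close>

definition GG_fiber ::
  "('p, 'n::finite) chart set \<Rightarrow> nat \<Rightarrow> nat \<Rightarrow> 'p \<Rightarrow> ('p jet \<Rightarrow> complex) set" where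
  "GG_fiber A k n x = {Q.
     (\<forall>J. J \<notin> jets_at A k x \<longrightarrow> Q J = 0) \<and>
     (\<forall>(U, \<phi>)\<in>A. x \<in> U \<longrightarrow>
        (\<exists>p. cpoly_vars p \<subseteq> UNIV \<times> {1..k} \<and>
           (\<forall>\<gamma>. hol_germ A \<gamma> \<and> \<gamma> 0 = x \<longrightarrow>
              Q (jet A k \<gamma>) = cpoly_eval (deriv_coord (\<phi> \<circ> \<gamma>)) p))) \<and>
     (\<forall>J\<in>jets_at A k x. \<forall>c. c \<noteq> 0 \<longrightarrow> Q (jet_scale A k c J) = c ^ n * Q J)}"


section \<open>Projective space\<close>

text \<open>The homogeneous coordinates on \<open>\<P>\<^sup>N\<close>, \<open>N = CARD('n)\<close>, are indexed by \<open>'n option\<close>, which has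
  \<open>N + 1\<close> elements; points are the lines through the origin in \<open>\<complex>\<close>\<open>\<^sup>N\<^sup>+\<^sup>1\<close>.\<close>

typedef ('n::finite) proj =
  "{range (\<lambda>c. c *s v) | v :: (complex, 'n option) vec. v \<noteq> 0}"
  morphisms line_of proj_of_line
proof -
  have "(1 :: (complex, 'n option) vec) \<noteq> 0" by simp
  then show ?thesis by blast
qed

definition proj_pt :: "(complex, 'n option) vec \<Rightarrow> 'n::finite proj" where
  "proj_pt v = proj_of_line (range (\<lambda>c. c *s v))"

definition chart_dom :: "'n option \<Rightarrow> 'n::finite proj set" where
  "chart_dom a = {x. \<exists>v\<in>line_of x. v $ a \<noteq> 0}"

definition normalized :: "'n option \<Rightarrow> 'n::finite proj \<Rightarrow> (complex, 'n option) vec" where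
  "normalized a x = (THE v. v \<in> line_of x \<and> v $ a = 1)"

text \<open>The standard chart on \<open>{X\<^sub>a \<noteq> 0}\<close> is \<open>(X\<^sub>b / X\<^sub>a)\<^bsub>b \<noteq> a\<^esub>\<close>. The map \<open>omit a\<close> is a bijection of
  \<open>'n\<close> onto the indices \<open>b \<noteq> a\<close>.\<close>

definition omit :: "'n option \<Rightarrow> 'n \<Rightarrow> 'n option" where
  "omit a j = (if a = Some j then None else Some j)"

definition chart_map :: "'n option \<Rightarrow> 'n::finite proj \<Rightarrow> (complex, 'n) vec" where
  "chart_map a x = (\<chi> j. normalized a x $ omit a j)"

definition proj_atlas :: "('n::finite proj, 'n) chart set" where
  "proj_atlas = range (\<lambda>a. (chart_dom a, chart_map a))"


section \<open>Twisted jet differentials on projective space\<close>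

text \<open>The line \<open>x\<close> is the fiber of \<open>\<O>(-1)\<close> at \<open>x\<close>, so the fiber of \<open>\<O>(d)\<close> consists of the
  functions on \<open>x\<close> that are homogeneous of degree \<open>d\<close> (extended by \<open>0\<close> off \<open>x\<close>). An element of
  \<open>(E\<^bsub>k,n\<^esub> \<otimes> \<O>(d))\<^sub>x\<close>, the second factor being one-dimensional, is a function of a jet and of a
  vector of \<open>x\<close> that lies in the respective factor in each variable.\<close>

definition O_fiber :: "nat \<Rightarrow> 'n::finite proj \<Rightarrow> ((complex, 'n option) vec \<Rightarrow> complex) set" where
  "O_fiber d x = {f. (\<forall>v. v \<notin> line_of x \<longrightarrow> f v = 0) \<and>
     (\<forall>v\<in>line_of x. \<forall>c. f (c *s v) = c ^ d * f v)}"

type_synonym 'n twisted = "'n proj jet \<Rightarrow> (complex, 'n option) vec \<Rightarrow> complex"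

definition twisted_fiber :: "nat \<Rightarrow> nat \<Rightarrow> nat \<Rightarrow> 'n::finite proj \<Rightarrow> 'n twisted set" where
  "twisted_fiber k n d x = {F. (\<forall>J. F J \<in> O_fiber d x) \<and>
     (\<forall>v. (\<lambda>J. F J v) \<in> GG_fiber proj_atlas k n x)}"

text \<open>Global holomorphic sections of \<open>E\<^bsub>k,n\<^esub>\<P>\<^sup>N(d)\<close>. Over \<open>{X\<^sub>a \<noteq> 0}\<close> the bundle \<open>E\<^bsub>k,n\<^esub>\<close> has the
  frame of the monomials of weight \<open>n\<close> in the fiber coordinates of the jet bundle, and \<open>\<O>(d)\<close> has the
  frame \<open>v \<mapsto> v\<^sub>a\<^sup>d\<close>; a section is holomorphic if its coefficients in these frames are.\<close>

definition GG_sections :: "nat \<Rightarrow> nat \<Rightarrow> nat \<Rightarrow> ('n::finite proj \<Rightarrow> 'n twisted) set" where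
  "GG_sections k n d = {s. (\<forall>x. s x \<in> twisted_fiber k n d x) \<and>
     (\<forall>a. \<exists>p :: 'n proj \<Rightarrow> ('n \<times> nat) cpoly.
        (\<forall>x\<in>chart_dom a. cpoly_vars (p x) \<subseteq> UNIV \<times> {1..k} \<and>
           (\<forall>\<gamma>. hol_germ proj_atlas \<gamma> \<and> \<gamma> 0 = x \<longrightarrow>
              (\<forall>v\<in>line_of x. s x (jet proj_atlas k \<gamma>) v =
                 cpoly_eval (deriv_coord (chart_map a \<circ> \<gamma>)) (p x) * (v $ a) ^ d))) \<and>
        (\<forall>m. holomorphic_mv
           (\<lambda>z. Poly_Mapping.lookup (p (inv_into (chart_dom a) (chart_map a) z)) m)
           (chart_map a ` chart_dom a)))}"

text \<open>\<open>H\<^sup>0(\<P>\<^sup>N, E\<^bsub>k,\<infinity>\<^esub>\<P>\<^sup>N(d))\<close>: a section of the direct sum of sheaves is a family, indexed by the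
  weight \<open>n\<close>, in which locally only finitely many members are nonzero.\<close>

type_synonym 'n graded_section = "nat \<Rightarrow> 'n proj \<Rightarrow> 'n twisted"

definition H0_GG :: "nat \<Rightarrow> nat \<Rightarrow> 'n::finite graded_section set" where
  "H0_GG k d = {s. (\<forall>n. s n \<in> GG_sections k n d) \<and>
     (\<forall>x. \<exists>a W. x \<in> chart_dom a \<and> open W \<and> chart_map a x \<in> W \<and>
        finite {n. \<exists>y\<in>chart_dom a. chart_map a y \<in> W \<and> s n y \<noteq> 0})}"

definition section_scale :: "complex \<Rightarrow> 'n graded_section \<Rightarrow> 'n graded_section" where
  "section_scale c s = (\<lambda>n x J v. c * s n x J v)"

definition section_value ::
  "'n graded_section \<Rightarrow> 'n proj \<Rightarrow> 'n proj jet \<Rightarrow> (complex, 'n option) vec \<Rightarrow> complex" where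
  "section_value s x J v = (\<Sum>n | s n x J v \<noteq> 0. s n x J v)"


section \<open>Isomorphisms between subspaces\<close>

definition subspace_iso ::
  "('f::field \<Rightarrow> 'b::ab_group_add \<Rightarrow> 'b) \<Rightarrow> 'b set \<Rightarrow>
   ('f \<Rightarrow> 'c::ab_group_add \<Rightarrow> 'c) \<Rightarrow> 'c set \<Rightarrow> ('b \<Rightarrow> 'c) \<Rightarrow> bool" where
  "subspace_iso s1 V s2 W f \<longleftrightarrow>
     vector_space s1 \<and> module.subspace s1 V \<and> vector_space s2 \<and> module.subspace s2 W \<and>
     bij_betw f V W \<and>
     (\<forall>x\<in>V. \<forall>y\<in>V. f (x + y) = f x + f y) \<and> (\<forall>c. \<forall>x\<in>V. f (s1 c x) = s2 c (f x))"

end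

theory Submission
  imports Defs "HOL-Complex_Analysis.Complex_Analysis"
begin

no_notation fps_nth (infixl \<open>$\<close> 75)

text \<open>A curve \<open>\<gamma>\<close> in \<open>\<P>\<^sup>N\<close> lifts to a curve \<open>g\<close> in \<open>\<complex>\<^sup>N\<^sup>+\<^sup>1\<close>, uniquely up to multiplication by a unit
  function \<open>q\<close>; differential homogeneity of \<open>P\<close> says exactly that \<open>P\<close>, evaluated at the derivatives
  of a lift with \<open>g(0) = v\<close>, depends only on the jet of \<open>\<gamma>\<close> and on \<open>v\<close>, and is homogeneous of degree
  \<open>d\<close> in \<open>v\<close>. The components of \<open>P\<close> of a given weight are again differentially homogeneous and
  give the sections of the individual \<open>E\<^bsub>k,n\<^esub>(d)\<close>.

  Conversely, a section of \<open>E\<^bsub>k,n\<^esub>(d)\<close> gives a function \<open>F\<close> of the derivatives of a lift, holomorphic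
  where \<open>g(0) \<noteq> 0\<close>, and homogeneous both of degree \<open>d\<close> and of weight \<open>n\<close>. In each single variable, as
  long as \<open>g(0)\<close> stays nonzero, \<open>F\<close> is entire, and the homogeneity bounds its growth, so that it is a
  polynomial of bounded degree by Liouville's theorem. Interpolation, first in one coordinate of
  \<open>g(0)\<close> at nonzero nodes, shows that \<open>F\<close> is a polynomial; this uses \<open>N \<ge> 1\<close> and replaces Hartogs'
  theorem. A differentially homogeneous polynomial of degree \<open>d\<close> and order \<open>k\<close> has weight at most
  \<open>k d\<close>, hence only finitely many weights occur.\<close>

section \<open>Evaluation of polynomials\<close>

definition mon_eval :: "('v \<Rightarrow> 'b::comm_monoid_mult) \<Rightarrow> ('v \<Rightarrow>\<^sub>0 nat) \<Rightarrow> 'b" where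
  "mon_eval g m = (\<Prod>v\<in>Poly_Mapping.keys m. g v ^ Poly_Mapping.lookup m v)"

lemma mon_eval_superset:
  assumes "finite S" "Poly_Mapping.keys m \<subseteq> S"
  shows "mon_eval g m = (\<Prod>v\<in>S. g v ^ Poly_Mapping.lookup m v)"
  unfolding mon_eval_def using assms by (intro prod.mono_neutral_left) (auto simp: in_keys_iff)

lemma mon_eval_0 [simp]: "mon_eval g 0 = 1"
  by (simp add: mon_eval_def)

lemma mon_eval_add: "mon_eval g (m + m') = mon_eval g m * mon_eval g m'"
proof -
  let ?S = "Poly_Mapping.keys m \<union> Poly_Mapping.keys m'"
  have "mon_eval g (m + m') = (\<Prod>v\<in>?S. g v ^ Poly_Mapping.lookup (m + m') v)"
    by (rule mon_eval_superset) (auto simp: keys_add)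
  also have "\<dots> = mon_eval g m * mon_eval g m'"
    by (simp add: mon_eval_superset[of ?S m] mon_eval_superset[of ?S m'] lookup_add power_add
        prod.distrib)
  finally show ?thesis .
qed

text \<open>Enlarging the index set lets two polynomials be summed over a common set in
  \<open>cpoly_eval_add\<close>, and lets the local coefficient polynomials at all points share one
  finite set of monomials in \<open>F_holomorphic\<close>.\<close>

lemma cpoly_eval_superset:
  assumes "finite S" "Poly_Mapping.keys P \<subseteq> S"
  shows "cpoly_eval x P = (\<Sum>m\<in>S. Poly_Mapping.lookup P m * mon_eval x m)"
  unfolding cpoly_eval_def cpoly_subst_def mon_eval_def[symmetric]
  using assms by (intro sum.mono_neutral_left) (auto simp: in_keys_iff)

lemma cpoly_eval_keys:
  "cpoly_eval x P = (\<Sum>m\<in>Poly_Mapping.keys P. Poly_Mapping.lookup P m * mon_eval x m)"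
  by (rule cpoly_eval_superset) auto

lemma cpoly_eval_0 [simp]: "cpoly_eval x 0 = 0"
  by (simp add: cpoly_eval_keys)

lemma cpoly_eval_single [simp]: "cpoly_eval x (Poly_Mapping.single m c) = c * mon_eval x m"
  by (simp add: cpoly_eval_keys)

lemma cpoly_eval_const [simp]: "cpoly_eval x (cpoly_const c) = c"
  by (simp add: cpoly_const_def)

lemma cpoly_eval_var [simp]: "cpoly_eval x (cpoly_var v) = x v"
  by (simp add: cpoly_var_def mon_eval_def)

lemma cpoly_eval_1 [simp]: "cpoly_eval x 1 = 1"
  using cpoly_eval_const[of x 1] by (simp add: cpoly_const_def)

lemma cpoly_eval_add [simp]: "cpoly_eval x (P + Q) = cpoly_eval x P + cpoly_eval x Q"
proof -
  let ?S = "Poly_Mapping.keys P \<union> Poly_Mapping.keys Q"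
  have "cpoly_eval x (P + Q) = (\<Sum>m\<in>?S. Poly_Mapping.lookup (P + Q) m * mon_eval x m)"
    by (rule cpoly_eval_superset) (auto simp: keys_add)
  also have "\<dots> = cpoly_eval x P + cpoly_eval x Q"
    by (simp add: cpoly_eval_superset[of ?S P] cpoly_eval_superset[of ?S Q] lookup_add
        sum.distrib algebra_simps)
  finally show ?thesis .
qed

lemma cpoly_eval_sum [simp]: "cpoly_eval x (\<Sum>i\<in>I. f i) = (\<Sum>i\<in>I. cpoly_eval x (f i))"
  by (induction I rule: infinite_finite_induct) auto

lemma cpoly_sum_single:
  "(P :: 'v cpoly) = (\<Sum>m\<in>Poly_Mapping.keys P. Poly_Mapping.single m (Poly_Mapping.lookup P m))"
  by (rule poly_mapping_eqI)
    (auto simp: lookup_sum lookup_single when_def in_keys_iff if_distrib sum.delta cong: if_cong)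

lemma cpoly_eval_mult [simp]: "cpoly_eval x (P * Q) = cpoly_eval x P * cpoly_eval x Q"
proof -
  let ?c = "Poly_Mapping.lookup"
  have "P * Q = (\<Sum>m\<in>Poly_Mapping.keys P. \<Sum>m'\<in>Poly_Mapping.keys Q.
      Poly_Mapping.single m (?c P m) * Poly_Mapping.single m' (?c Q m'))"
    by (subst (1) cpoly_sum_single[of P], subst (1) cpoly_sum_single[of Q]) (rule sum_product)
  then have "cpoly_eval x (P * Q) = (\<Sum>m\<in>Poly_Mapping.keys P. \<Sum>m'\<in>Poly_Mapping.keys Q.
      ?c P m * ?c Q m' * mon_eval x (m + m'))"
    by (simp add: mult_single)
  then show ?thesis
    by (simp add: mon_eval_add cpoly_eval_keys[of x P] cpoly_eval_keys[of x Q] sum_product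
        algebra_simps)
qed

lemma cpoly_eval_power [simp]: "cpoly_eval x (P ^ n) = cpoly_eval x P ^ n"
  by (induction n) auto

lemma cpoly_eval_prod [simp]: "cpoly_eval x (\<Prod>i\<in>I. f i) = (\<Prod>i\<in>I. cpoly_eval x (f i))"
  by (induction I rule: infinite_finite_induct) auto

lemma cpoly_eval_of_nat [simp]: "cpoly_eval x (of_nat n) = of_nat n"
  by (induction n) auto

lemma cpoly_eval_uminus [simp]: "cpoly_eval x (- P) = - cpoly_eval x P"
  using cpoly_eval_add[of x P "- P"] by (simp add: add_eq_0_iff del: cpoly_eval_add)

lemma cpoly_eval_diff [simp]: "cpoly_eval x (P - Q) = cpoly_eval x P - cpoly_eval x Q"
  using cpoly_eval_add[of x P "- Q"] by (simp del: cpoly_eval_add)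

lemma cpoly_eval_scale [simp]: "cpoly_eval x (cpoly_scale c P) = c * cpoly_eval x P"
  by (simp add: cpoly_scale_def)

lemma lookup_cpoly_scale [simp]:
  "Poly_Mapping.lookup (cpoly_scale c P) m = c * Poly_Mapping.lookup P m"
proof -
  have "cpoly_scale c P = Poly_Mapping.map ((*) c) P"
    by (simp add: cpoly_scale_def cpoly_const_def mult_map_scale_conv_mult)
  then show ?thesis by (simp add: Poly_Mapping.map.rep_eq when_def)
qed

lemma vector_space_cpoly_scale: "vector_space (cpoly_scale :: complex \<Rightarrow> 'v cpoly \<Rightarrow> 'v cpoly)"
  by unfold_locales (auto intro!: poly_mapping_eqI simp: lookup_add algebra_simps)

lemma cpoly_eval_cong:
  assumes "\<And>v. v \<in> cpoly_vars P \<Longrightarrow> x v = y v"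
  shows "cpoly_eval x P = cpoly_eval y P"
  unfolding cpoly_eval_keys mon_eval_def
  by (intro sum.cong prod.cong arg_cong2[where f = "(*)"] refl)
    (use assms in \<open>force simp: cpoly_vars_def\<close>)

lemma cpoly_eval_subst:
  assumes "\<And>c. cpoly_eval x (h c) = c"
  shows "cpoly_eval x (cpoly_subst h g P) = cpoly_eval (\<lambda>v. cpoly_eval x (g v)) P"
  by (simp add: cpoly_subst_def assms cpoly_eval_keys[of _ P] mon_eval_def)

lemma tendsto_cpoly_eval:
  assumes "\<And>v. ((\<lambda>t. x t v) \<longlongrightarrow> y v) F"
  shows "((\<lambda>t. cpoly_eval (x t) P) \<longlongrightarrow> cpoly_eval y P) F"
  unfolding cpoly_eval_keys mon_eval_def by (intro tendsto_intros assms)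

lemma holomorphic_on_mon_eval:
  assumes "\<And>v. v \<in> Poly_Mapping.keys m \<Longrightarrow> (\<lambda>t. x t v) holomorphic_on S"
  shows "(\<lambda>t. mon_eval (x t) m) holomorphic_on S"
  unfolding mon_eval_def by (intro holomorphic_intros assms)

section \<open>Weighted components\<close>

definition mon_weight :: "('v \<Rightarrow> nat) \<Rightarrow> ('v \<Rightarrow>\<^sub>0 nat) \<Rightarrow> nat" where
  "mon_weight \<omega> m = (\<Sum>v\<in>Poly_Mapping.keys m. \<omega> v * Poly_Mapping.lookup m v)"

definition weight_comp :: "('v \<Rightarrow> nat) \<Rightarrow> nat \<Rightarrow> 'v cpoly \<Rightarrow> 'v cpoly" where
  "weight_comp \<omega> n P = (\<Sum>m\<in>{m \<in> Poly_Mapping.keys P. mon_weight \<omega> m = n}.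
     Poly_Mapping.single m (Poly_Mapping.lookup P m))"

lemma lookup_weight_comp:
  "Poly_Mapping.lookup (weight_comp \<omega> n P) m =
     (if mon_weight \<omega> m = n then Poly_Mapping.lookup P m else 0)"
proof -
  let ?S = "{m \<in> Poly_Mapping.keys P. mon_weight \<omega> m = n}"
  have "Poly_Mapping.lookup (weight_comp \<omega> n P) m =
      (\<Sum>m'\<in>?S. if m' = m then Poly_Mapping.lookup P m' else 0)"
    by (simp add: weight_comp_def lookup_sum lookup_single when_def)
  also have "\<dots> = (if m \<in> ?S then Poly_Mapping.lookup P m else 0)"
    by (rule sum.delta) simp
  finally show ?thesis by (auto simp: in_keys_iff)
qed

lemma keys_weight_comp:
  "Poly_Mapping.keys (weight_comp \<omega> n P) = {m \<in> Poly_Mapping.keys P. mon_weight \<omega> m = n}"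
  by (auto simp: in_keys_iff lookup_weight_comp split: if_splits)

lemma vars_weight_comp: "cpoly_vars (weight_comp \<omega> n P) \<subseteq> cpoly_vars P"
  by (auto simp: cpoly_vars_def keys_weight_comp)

lemma weight_comp_add: "weight_comp \<omega> n (P + Q) = weight_comp \<omega> n P + weight_comp \<omega> n Q"
  by (rule poly_mapping_eqI) (simp add: lookup_weight_comp lookup_add)

lemma weight_comp_scale: "weight_comp \<omega> n (cpoly_scale c P) = cpoly_scale c (weight_comp \<omega> n P)"
  by (rule poly_mapping_eqI) (simp add: lookup_weight_comp)

lemma weight_comp_eq_0:
  "n \<notin> mon_weight \<omega> ` Poly_Mapping.keys P \<Longrightarrow> weight_comp \<omega> n P = 0"
  by (rule poly_mapping_eqI) (auto simp: lookup_weight_comp in_keys_iff)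

lemma sum_weight_comp:
  assumes "finite S" "mon_weight \<omega> ` Poly_Mapping.keys P \<subseteq> S"
  shows "(\<Sum>n\<in>S. weight_comp \<omega> n P) = P"
proof (rule poly_mapping_eqI)
  fix m
  have "Poly_Mapping.lookup (\<Sum>n\<in>S. weight_comp \<omega> n P) m =
      (if mon_weight \<omega> m \<in> S then Poly_Mapping.lookup P m else 0)"
    using assms(1) by (simp add: lookup_sum lookup_weight_comp)
  then show "Poly_Mapping.lookup (\<Sum>n\<in>S. weight_comp \<omega> n P) m = Poly_Mapping.lookup P m"
    using assms(2) by (cases "m \<in> Poly_Mapping.keys P") (auto simp: in_keys_iff)
qed

lemma mon_eval_scale:
  "mon_eval (\<lambda>v. c ^ \<omega> v * x v) m = c ^ mon_weight \<omega> m * mon_eval x (m :: 'v \<Rightarrow>\<^sub>0 nat)"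
  for c :: complex
  by (simp add: mon_eval_def mon_weight_def power_mult_distrib prod.distrib power_sum power_mult)

lemma cpoly_eval_scale_weight_comp:
  "cpoly_eval (\<lambda>v. c ^ \<omega> v * x v) (weight_comp \<omega> n P) =
     c ^ n * cpoly_eval x (weight_comp \<omega> n P)"
  unfolding cpoly_eval_keys keys_weight_comp mon_eval_scale sum_distrib_left
  by (intro sum.cong) auto

text \<open>As a function of \<open>c\<close> the right side is a polynomial whose coefficients are
  the values of the weight components, so these can be recovered by comparing coefficients with
  \<open>power_sums_eqD\<close>.\<close>

lemma cpoly_eval_scale_weights:
  assumes "finite S" "mon_weight \<omega> ` Poly_Mapping.keys P \<subseteq> S"
  shows "cpoly_eval (\<lambda>v. c ^ \<omega> v * x v) P = (\<Sum>n\<in>S. c ^ n * cpoly_eval x (weight_comp \<omega> n P))"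
  by (subst sum_weight_comp[OF assms, symmetric])
    (simp add: cpoly_eval_scale_weight_comp del: sum_weight_comp)

text \<open>The difference of the two sides is a polynomial in \<open>c\<close> with infinitely many
  roots. The value \<open>c = 0\<close> is left out because the scaling laws of jets are available
  only for nonzero factors.\<close>

lemma power_sums_eqD:
  fixes f g :: "nat \<Rightarrow> complex"
  assumes "finite S" "\<And>c. c \<noteq> 0 \<Longrightarrow> (\<Sum>n\<in>S. c ^ n * f n) = (\<Sum>n\<in>S. c ^ n * g n)" "n \<in> S"
  shows "f n = g n"
proof -
  define p where "p = (\<Sum>n\<in>S. monom (f n - g n) n)"
  have "poly p c = 0" if "c \<noteq> 0" for c
    using assms(2)[OF that] by (simp add: p_def poly_sum poly_monom algebra_simps sum_subtractf)
  then have "UNIV - {0} \<subseteq> {c. poly p c = 0}" by auto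
  moreover have "infinite (UNIV - {0 :: complex})"
    by (simp add: infinite_UNIV_char_0)
  ultimately have "p = 0" using poly_roots_finite infinite_super by blast
  moreover have "coeff p n = f n - g n"
    using assms by (simp add: p_def coeff_sum)
  ultimately show ?thesis by simp
qed

text \<open>Induction on the number of monomials. Two distinct monomials differ in the exponent of
  some variable \<open>v\<close>; grading by that exponent splits \<open>P\<close> into components
  with fewer monomials, and by \<open>power_sums_eqD\<close> each of them vanishes everywhere as
  well.\<close>

lemma cpoly_eval_eq_0:
  assumes "\<And>x. cpoly_eval x P = 0"
  shows "P = 0"
  using assms
proof (induction "card (Poly_Mapping.keys P)" arbitrary: P rule: less_induct)
  case less
  show ?case
  proof (rule ccontr)
    assume "P \<noteq> 0"
    then obtain m where m: "m \<in> Poly_Mapping.keys P"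
      by (metis keys_eq_empty ex_in_conv)
    have "Poly_Mapping.keys P \<noteq> {m}"
    proof
      assume "Poly_Mapping.keys P = {m}"
      then have "cpoly_eval (\<lambda>_. 1) P = Poly_Mapping.lookup P m"
        by (simp add: cpoly_eval_keys mon_eval_def)
      then show False using m less.prems by (simp add: in_keys_iff)
    qed
    then obtain m' where m': "m' \<in> Poly_Mapping.keys P" "m' \<noteq> m" using m by auto
    obtain v where v: "Poly_Mapping.lookup m v \<noteq> Poly_Mapping.lookup m' v"
      using m'(2) by (metis poly_mapping_eqI)
    \<comment> \<open>With this weight, \<open>mon_weight\<close> reads off the exponent of
      \<open>v\<close>.\<close>
    define \<omega> where "\<omega> u = (if u = v then 1 else 0 :: nat)" for u
    have \<omega>: "mon_weight \<omega> k = Poly_Mapping.lookup k v" for k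
      by (auto simp: mon_weight_def \<omega>_def if_distrib[of "\<lambda>c. c * _"] in_keys_iff cong: if_cong)
    let ?N = "mon_weight \<omega> ` Poly_Mapping.keys P"
    have "weight_comp \<omega> n P = 0" if n: "n \<in> ?N" for n
    proof (rule less.hyps)
      have "\<exists>k\<in>Poly_Mapping.keys P. mon_weight \<omega> k \<noteq> n"
        using m m'(1) v \<omega> by metis
      then have "Poly_Mapping.keys (weight_comp \<omega> n P) \<subset> Poly_Mapping.keys P"
        by (auto simp: keys_weight_comp)
      then show "card (Poly_Mapping.keys (weight_comp \<omega> n P)) < card (Poly_Mapping.keys P)"
        by (intro psubset_card_mono) auto
      show "cpoly_eval x (weight_comp \<omega> n P) = 0" for x
        by (rule power_sums_eqD[of ?N _ "\<lambda>_. 0"])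
          (use n less.prems in \<open>simp_all flip: cpoly_eval_scale_weights\<close>)
    qed
    then have "P = 0" using sum_weight_comp[of ?N \<omega> P] by simp
    then show False using \<open>P \<noteq> 0\<close> by simp
  qed
qed

lemma cpoly_eqI: "(\<And>x. cpoly_eval x P = cpoly_eval x Q) \<Longrightarrow> P = Q"
  using cpoly_eval_eq_0[of "P - Q"] by simp

lemma weight_homogeneous_keys:
  assumes "\<And>x c. c \<noteq> 0 \<Longrightarrow> cpoly_eval (\<lambda>v. c ^ \<omega> v * x v) P = c ^ n * cpoly_eval x P"
  shows "weight_comp \<omega> n P = P" "m \<in> Poly_Mapping.keys P \<Longrightarrow> mon_weight \<omega> m = n"
proof -
  let ?N = "insert n (mon_weight \<omega> ` Poly_Mapping.keys P)"
  show 1: "weight_comp \<omega> n P = P"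
  proof (rule cpoly_eqI)
    fix x
    \<comment> \<open>The hypothesis is rewritten as an equality of two polynomials in
      \<open>c\<close>, the second one having its only term in degree \<open>n\<close>.\<close>
    have "(\<Sum>n'\<in>?N. c ^ n' * cpoly_eval x (weight_comp \<omega> n' P)) =
        (\<Sum>n'\<in>?N. c ^ n' * (if n' = n then cpoly_eval x P else 0))" if "c \<noteq> 0" for c
      using assms[OF that] cpoly_eval_scale_weights[of ?N \<omega> P c x]
      by (simp add: if_distrib[of "\<lambda>a. _ * a"] sum.delta subset_insertI del: sum.insert cong: if_cong)
    from power_sums_eqD[OF _ this, of n] show "cpoly_eval x (weight_comp \<omega> n P) = cpoly_eval x P"
      by simp
  qed
  show "mon_weight \<omega> m = n" if "m \<in> Poly_Mapping.keys P"
    using that keys_weight_comp[of \<omega> n P] 1 by auto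
qed

section \<open>Differential homogeneity in terms of power series\<close>

text \<open>The factorial turns Taylor coefficients into derivatives at the origin. In these
  coordinates the Leibniz rule built into \<open>QX\<close> becomes multiplication of power
  series.\<close>

definition jet_coords :: "('i \<Rightarrow> complex fps) \<Rightarrow> 'i \<times> nat \<Rightarrow> complex" where
  "jet_coords u = (\<lambda>(i, m). fact m * fps_nth (u i) m)"

lemma jet_coords_apply [simp]: "jet_coords u (i, m) = fact m * fps_nth (u i) m"
  by (simp add: jet_coords_def)

text \<open>A pointwise form of differential homogeneity, with formal power series in place of
  polynomials in \<open>T\<close>. It applies directly to Taylor expansions of lifts;
  \<open>diff_homogeneous_iff\<close> shows that nothing is changed.\<close>

definition jet_homogeneous :: "nat \<Rightarrow> 'i diffpoly \<Rightarrow> bool" where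
  "jet_homogeneous d P \<longleftrightarrow>
     (\<forall>q u. cpoly_eval (jet_coords (\<lambda>i. q * u i)) P = fps_nth q 0 ^ d * cpoly_eval (jet_coords u) P)"

lemma jet_coords_surj: "\<exists>u. jet_coords u = x"
  by (rule exI[of _ "\<lambda>i. Abs_fps (\<lambda>m. x (i, m) / fact m)"]) (auto simp: jet_coords_def)

lemma jet_coords_mult:
  "jet_coords (\<lambda>i. q * u i) (i, m) =
     (\<Sum>l\<le>m. of_nat (m choose l) * (fact (m - l) * fps_nth q (m - l)) * jet_coords u (i, l))"
proof -
  have "jet_coords (\<lambda>i. q * u i) (i, m) =
      (\<Sum>l=0..m. fact m * (fps_nth (u i) l * fps_nth q (m - l)))"
    by (simp add: mult.commute[of q] fps_mult_nth sum_distrib_left)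
  also have "\<dots> = (\<Sum>l\<le>m. of_nat (m choose l) * (fact (m - l) * fps_nth q (m - l)) *
      jet_coords u (i, l))"
    by (intro sum.cong) (auto simp: binomial_fact)
  finally show ?thesis .
qed

definition eval_at :: "('v \<Rightarrow> complex) \<Rightarrow> complex \<Rightarrow> 'v cpoly poly \<Rightarrow> complex" where
  "eval_at x t R = cpoly_eval x (poly R (cpoly_const t))"

lemma poly_map_poly_cpoly_const:
  "poly (map_poly cpoly_const Q) (cpoly_const t) = cpoly_const (poly Q t)"
proof -
  have [simp]: "cpoly_const 0 = 0" by (simp add: cpoly_const_def)
  show ?thesis
    by (induction Q) (simp_all add: map_poly_pCons, simp add: cpoly_const_def single_add mult_single)
qed

text \<open>For fixed \<open>x\<close> the values in \<open>t\<close> determine the coefficients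
  evaluated at \<open>x\<close>, and letting \<open>x\<close> vary determines the coefficients
  themselves.\<close>

lemma eval_at_eqI:
  assumes "\<And>x t. eval_at x t R = eval_at x t R'"
  shows "R = R'"
proof (rule poly_eqI, rule cpoly_eqI)
  fix n x
  let ?r = "\<lambda>R :: 'a cpoly poly. \<lambda>i. cpoly_eval x (coeff R i)"
  have e: "eval_at x t S = (\<Sum>i\<le>N. t ^ i * ?r S i)" if "degree S \<le> N" for S N t
  proof -
    have "eval_at x t S = (\<Sum>i\<le>degree S. t ^ i * ?r S i)"
      by (simp add: eval_at_def poly_altdef mult.commute)
    also have "\<dots> = (\<Sum>i\<le>N. t ^ i * ?r S i)"
      using that by (intro sum.mono_neutral_left) (auto simp: coeff_eq_0)
    finally show ?thesis .
  qed
  \<comment> \<open>The summation bound exceeds both degrees and, by the summand \<open>n\<close>,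
    also covers the coefficient in question.\<close>
  show "?r R n = ?r R' n"
    by (rule power_sums_eqD[of "{..degree R + degree R' + n}"]) (use assms in \<open>auto simp flip: e\<close>)
qed

lemma eval_at_subst:
  "eval_at x t (cpoly_subst (\<lambda>c. [:cpoly_const c:]) g P) = cpoly_eval (\<lambda>v. eval_at x t (g v)) P"
  by (simp add: eval_at_def cpoly_subst_def poly_sum poly_prod cpoly_eval_keys[of _ P] mon_eval_def)

lemma eval_at_QX:
  "eval_at x t (QX Q i m) =
     (\<Sum>l\<le>m. of_nat (m choose l) * poly ((pderiv ^^ (m - l)) Q) t * x (i, l))"
  by (simp add: eval_at_def QX_def poly_sum poly_map_poly_cpoly_const mult.commute)

text \<open>Only derivatives up to order \<open>k\<close> occur in \<open>P\<close>, so
  \<open>q\<close> has to match the Taylor expansion of \<open>Q\<close> at \<open>t\<close> only up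
  to that order. This leaves room for truncating a power series to a polynomial.\<close>

lemma eval_at_diff_act:
  assumes "\<And>i m. (i, m) \<in> cpoly_vars P \<Longrightarrow> m \<le> k"
    and "\<And>j. j \<le> k \<Longrightarrow> fact j * fps_nth q j = poly ((pderiv ^^ j) Q) t"
  shows "eval_at (jet_coords u) t (diff_act Q P) = cpoly_eval (jet_coords (\<lambda>i. q * u i)) P"
  unfolding diff_act_def eval_at_subst
proof (rule cpoly_eval_cong, safe)
  fix i m assume "(i, m) \<in> cpoly_vars P"
  then have "m \<le> k" by (rule assms(1))
  then show "eval_at (jet_coords u) t (QX Q i m) = jet_coords (\<lambda>i. q * u i) (i, m)"
    unfolding jet_coords_mult eval_at_QX by (intro sum.cong) (simp_all flip: assms(2))
qed

lemma eval_at_scaled: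
  "eval_at x t (map_poly cpoly_const Q ^ d * [:P:]) = poly Q t ^ d * cpoly_eval x P"
  by (simp add: eval_at_def poly_map_poly_cpoly_const)

lemma finite_cpoly_vars [simp]: "finite (cpoly_vars P)"
  by (simp add: cpoly_vars_def)

text \<open>From left to right, \<open>q\<close> is truncated to a polynomial \<open>Q\<close> and
  the identity in \<open>V[T]\<close> is read at \<open>T = 0\<close>. Conversely, the identity at
  \<open>T = t\<close> is the power series identity for the Taylor series of \<open>Q\<close> at
  \<open>t\<close>.\<close>

lemma diff_homogeneous_iff: "diff_homogeneous d P \<longleftrightarrow> jet_homogeneous d P"
proof
  assume P: "diff_homogeneous d P"
  show "jet_homogeneous d P"
    unfolding jet_homogeneous_def
  proof safe
    fix q :: "complex fps" and u
    define k where "k = Max (snd ` cpoly_vars P)"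
    define Q where "Q = (\<Sum>j\<le>k. monom (fps_nth q j) j)"
    have k: "m \<le> k" if "(i, m) \<in> cpoly_vars P" for i m
      using that unfolding k_def by (intro Max_ge) force+
    have Q: "fact j * fps_nth q j = poly ((pderiv ^^ j) Q) 0" if "j \<le> k" for j
      using that
      by (simp add: poly_0_coeff_0 coeff_higher_pderiv Q_def coeff_sum flip: pochhammer_fact)
    have "cpoly_eval (jet_coords (\<lambda>i. q * u i)) P = eval_at (jet_coords u) 0 (diff_act Q P)"
      by (rule eval_at_diff_act[symmetric, OF k Q])
    also have "\<dots> = poly Q 0 ^ d * cpoly_eval (jet_coords u) P"
      using P by (simp only: diff_homogeneous_def eval_at_scaled)
    finally show "cpoly_eval (jet_coords (\<lambda>i. q * u i)) P =
        fps_nth q 0 ^ d * cpoly_eval (jet_coords u) P"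
      using Q[of 0] by simp
  qed
next
  assume P: "jet_homogeneous d P"
  show "diff_homogeneous d P"
    unfolding diff_homogeneous_def
  proof (safe, rule eval_at_eqI)
    fix Q :: "complex poly" and x :: "'a \<times> nat \<Rightarrow> complex" and t
    obtain u where u: "jet_coords u = x" using jet_coords_surj by metis
    define q where "q = Abs_fps (\<lambda>j. poly ((pderiv ^^ j) Q) t / fact j)"
    have "eval_at x t (diff_act Q P) = cpoly_eval (jet_coords (\<lambda>i. q * u i)) P"
      unfolding u[symmetric]
      by (rule eval_at_diff_act[of _ "Max (snd ` cpoly_vars P)"]) (force simp: q_def intro!: Max_ge)+
    also have "\<dots> = poly Q t ^ d * cpoly_eval x P"
      using P u by (simp add: jet_homogeneous_def q_def)
    finally show "eval_at x t (diff_act Q P) = eval_at x t (map_poly cpoly_const Q ^ d * [:P:])"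
      by (simp only: eval_at_scaled)
  qed
qed

lemma V_diff_altdef: "V_diff d k = {P. jet_homogeneous d P \<and> cpoly_vars P \<subseteq> UNIV \<times> {..k}}"
  by (simp add: V_diff_def diff_homogeneous_iff)

lemma cpoly_vars_add: "cpoly_vars (P + Q) \<subseteq> cpoly_vars P \<union> cpoly_vars Q"
  using keys_add[of P Q] by (auto simp: cpoly_vars_def)

lemma cpoly_vars_scale: "cpoly_vars (cpoly_scale c P) \<subseteq> cpoly_vars P"
  by (auto simp: cpoly_vars_def in_keys_iff)

lemma cpoly_vars_0 [simp]: "cpoly_vars 0 = {}"
  by (simp add: cpoly_vars_def)

lemma V_diff_add: "P \<in> V_diff d k \<Longrightarrow> Q \<in> V_diff d k \<Longrightarrow> P + Q \<in> V_diff d k"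
  using cpoly_vars_add[of P Q] by (auto simp: V_diff_altdef jet_homogeneous_def algebra_simps)

lemma V_diff_scale: "P \<in> V_diff d k \<Longrightarrow> cpoly_scale c P \<in> V_diff d k"
  using cpoly_vars_scale[of c P] by (auto simp: V_diff_altdef jet_homogeneous_def)

lemma V_diff_0: "0 \<in> V_diff d k"
  by (simp add: V_diff_altdef jet_homogeneous_def)

lemma V_diff_sum: "(\<And>i. i \<in> I \<Longrightarrow> f i \<in> V_diff d k) \<Longrightarrow> sum f I \<in> V_diff d k"
  by (induction I rule: infinite_finite_induct) (auto intro: V_diff_add V_diff_0)

section \<open>Rescaling of power series and the components of a given weight\<close>

definition fps_rescale :: "complex \<Rightarrow> complex fps \<Rightarrow> complex fps" where
  "fps_rescale c f = Abs_fps (\<lambda>n. c ^ n * fps_nth f n)"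

lemma fps_nth_rescale [simp]: "fps_nth (fps_rescale c f) n = c ^ n * fps_nth f n"
  by (simp add: fps_rescale_def)

lemma fps_rescale_mult: "fps_rescale c (f * g) = fps_rescale c f * fps_rescale c g"
  by (rule fps_ext)
    (auto simp: fps_mult_nth sum_distrib_left algebra_simps simp flip: power_add intro!: sum.cong)

lemma jet_coords_rescale:
  "jet_coords (\<lambda>i. fps_rescale c (u i)) = (\<lambda>v. c ^ snd v * jet_coords u v)"
  by (auto simp: jet_coords_def)

text \<open>Rescaling \<open>T\<close> to \<open>c T\<close> maps products to products, so comparing the coefficients of \<open>c\<^sup>n\<close>
  in the homogeneity identity gives the identity for the component of weight \<open>n\<close>.\<close>

lemma jet_homogeneous_weight_comp:
  assumes "jet_homogeneous d P"
  shows "jet_homogeneous d (weight_comp snd n P)"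
  unfolding jet_homogeneous_def
proof safe
  fix q u
  let ?N = "insert n (mon_weight snd ` Poly_Mapping.keys P)"
  have w: "(\<Sum>n\<in>?N. c ^ n * cpoly_eval (jet_coords u) (weight_comp snd n P)) =
      cpoly_eval (jet_coords (\<lambda>i. fps_rescale c (u i))) P" for c and u :: "'a \<Rightarrow> complex fps"
    unfolding jet_coords_rescale by (rule cpoly_eval_scale_weights[symmetric]) auto
  show "cpoly_eval (jet_coords (\<lambda>i. q * u i)) (weight_comp snd n P) =
      fps_nth q 0 ^ d * cpoly_eval (jet_coords u) (weight_comp snd n P)"
  proof (rule power_sums_eqD[of ?N "\<lambda>n. cpoly_eval (jet_coords (\<lambda>i. q * u i)) (weight_comp snd n P)"
        "\<lambda>n. fps_nth q 0 ^ d * cpoly_eval (jet_coords u) (weight_comp snd n P)"])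
    fix c
    have "(\<Sum>n\<in>?N. c ^ n * cpoly_eval (jet_coords (\<lambda>i. q * u i)) (weight_comp snd n P)) =
        fps_nth q 0 ^ d * (\<Sum>n\<in>?N. c ^ n * cpoly_eval (jet_coords u) (weight_comp snd n P))"
      unfolding w fps_rescale_mult using assms by (simp add: jet_homogeneous_def)
    then show "(\<Sum>n\<in>?N. c ^ n * cpoly_eval (jet_coords (\<lambda>i. q * u i)) (weight_comp snd n P)) =
        (\<Sum>n\<in>?N. c ^ n * (fps_nth q 0 ^ d * cpoly_eval (jet_coords u) (weight_comp snd n P)))"
      unfolding sum_distrib_left by (simp only: mult.left_commute)
  qed auto
qed

lemma V_diff_weight_comp: "P \<in> V_diff d k \<Longrightarrow> weight_comp snd n P \<in> V_diff d k"
  using vars_weight_comp[of snd n P] by (auto simp: V_diff_altdef jet_homogeneous_weight_comp)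

section \<open>Points and charts of projective space\<close>

lemma line_of_proj_pt:
  assumes "v \<noteq> 0"
  shows "line_of (proj_pt v) = range (\<lambda>c. c *s v)"
  unfolding proj_pt_def using assms by (intro proj_of_line_inverse) blast

lemma proj_pt_exhaust:
  obtains v where "v \<noteq> 0" "x = proj_pt v"
proof -
  obtain v where v: "v \<noteq> 0" "line_of x = range (\<lambda>c. c *s v)"
    using line_of[of x] by blast
  then have "x = proj_pt v"
    by (metis line_of_proj_pt line_of_inject)
  with v that show ?thesis by blast
qed

lemma proj_pt_scale:
  assumes "c \<noteq> 0"
  shows "proj_pt (c *s v) = proj_pt v"
proof -
  have "range (\<lambda>b. b *s (c *s v)) = range (\<lambda>b. b *s v)"
  proof safe
    fix b show "b *s v \<in> range (\<lambda>b. b *s (c *s v))"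
      using assms by (intro image_eqI[of _ _ "b / c"]) auto
  qed auto
  then show ?thesis by (simp add: proj_pt_def)
qed

lemma proj_pt_in_line: "v \<in> line_of x \<Longrightarrow> v \<noteq> 0 \<Longrightarrow> proj_pt v = x"
  by (rule proj_pt_exhaust[of x]) (auto simp: line_of_proj_pt proj_pt_scale)

lemma in_line_of_proj_pt: "v \<noteq> 0 \<Longrightarrow> v \<in> line_of (proj_pt v)"
  by (auto simp: line_of_proj_pt intro: image_eqI[of _ _ 1])

lemma line_of_scale: "v \<in> line_of x \<Longrightarrow> c *s v \<in> line_of x"
  by (rule proj_pt_exhaust[of x]) (auto simp: line_of_proj_pt vector_smult_assoc)

lemma proj_pt_in_chart_dom:
  assumes "v \<noteq> 0"
  shows "proj_pt v \<in> chart_dom a \<longleftrightarrow> v $ a \<noteq> 0"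
  using assms by (auto simp: chart_dom_def line_of_proj_pt intro: exI[of _ 1])

lemma normalized_proj_pt:
  assumes "v $ a \<noteq> 0"
  shows "normalized a (proj_pt v) = inverse (v $ a) *s v"
proof -
  have "v \<noteq> 0" using assms by auto
  then show ?thesis
    unfolding normalized_def line_of_proj_pt[OF \<open>v \<noteq> 0\<close>]
    using assms by (intro the_equality) (auto simp: field_simps)
qed

lemma in_chart_domE:
  assumes "x \<in> chart_dom a"
  obtains v where "v $ a \<noteq> 0" "v \<noteq> 0" "x = proj_pt v"
  using assms proj_pt_in_chart_dom proj_pt_exhaust by metis

lemma
  assumes "x \<in> chart_dom a"
  shows normalized_nth_self: "normalized a x $ a = 1"
    and proj_pt_normalized: "proj_pt (normalized a x) = x"
    and normalized_nonzero: "normalized a x \<noteq> 0"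
proof -
  obtain v where v: "v $ a \<noteq> 0" "v \<noteq> 0" "x = proj_pt v" using assms by (rule in_chart_domE)
  then show 1: "normalized a x $ a = 1" by (simp add: normalized_proj_pt)
  then show "normalized a x \<noteq> 0" by auto
  show "proj_pt (normalized a x) = x"
    using v by (simp add: normalized_proj_pt proj_pt_scale)
qed

lemma line_of_normalized:
  assumes "v \<in> line_of x" "x \<in> chart_dom a"
  shows "v = (v $ a) *s normalized a x"
proof -
  obtain c where "v = c *s normalized a x"
    using assms line_of_proj_pt[OF normalized_nonzero[OF assms(2)]] proj_pt_normalized[OF assms(2)]
    by auto
  then show ?thesis using normalized_nth_self[OF assms(2)] by simp
qed

lemma chart_dom_cover: "\<exists>a. x \<in> chart_dom a"
proof -
  obtain v where "v \<noteq> 0" "x = proj_pt v" by (rule proj_pt_exhaust)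
  moreover from this obtain a where "v $ a \<noteq> 0" by (auto simp: vec_eq_iff)
  ultimately show ?thesis using proj_pt_in_chart_dom by blast
qed

lemma normalized_nth_nonzero:
  assumes "x \<in> chart_dom a" "x \<in> chart_dom b"
  shows "normalized a x $ b \<noteq> 0"
  using assms proj_pt_in_chart_dom normalized_nonzero proj_pt_normalized by metis

lemma omit_neq [simp]: "omit a j \<noteq> a"
  by (auto simp: omit_def)

lemma inj_omit: "inj (omit a)"
  by (auto simp: inj_def omit_def split: if_splits)

lemma omit_cases:
  obtains "i = a" | j where "i = omit a j"
proof (cases "i = a")
  case False
  then have "\<exists>j. i = omit a j"
    by (cases i) (auto simp: omit_def split: if_splits intro: exI[of _ "the i"] exI[of _ "the a"])
  then show ?thesis using that by blast
qed (use that in blast)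

lemma chart_map_nth: "chart_map a x $ j = normalized a x $ omit a j"
  by (simp add: chart_map_def)

text \<open>The representative, normalized by \<open>X_a = 1\<close>, of the point with affine
  coordinates \<open>z\<close>. It provides the inverse of \<open>chart_map a\<close> and shows that
  the chart is onto the whole affine space.\<close>

definition affine_lift :: "'n option \<Rightarrow> (complex, 'n) vec \<Rightarrow> (complex, 'n::finite option) vec" where
  "affine_lift a z = (\<chi> i. if i = a then 1 else z $ inv (omit a) i)"

lemma affine_lift_self [simp]: "affine_lift a z $ a = 1"
  by (simp add: affine_lift_def)

lemma affine_lift_omit [simp]: "affine_lift a z $ omit a j = z $ j"
  by (simp add: affine_lift_def inv_f_f[OF inj_omit])

lemma affine_lift_nonzero [simp]: "affine_lift a z \<noteq> 0"
  by (metis affine_lift_self zero_index zero_neq_one)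

lemma affine_lift_in_chart_dom: "proj_pt (affine_lift a z) \<in> chart_dom a"
  by (simp add: proj_pt_in_chart_dom)

lemma chart_map_affine_lift [simp]: "chart_map a (proj_pt (affine_lift a z)) = z"
  by (simp add: vec_eq_iff chart_map_nth normalized_proj_pt)

lemma affine_lift_chart_map:
  assumes "x \<in> chart_dom a"
  shows "affine_lift a (chart_map a x) = normalized a x"
  unfolding vec_eq_iff
proof
  fix i show "affine_lift a (chart_map a x) $ i = normalized a x $ i"
    by (cases rule: omit_cases[of i a]) (auto simp: normalized_nth_self[OF assms] chart_map_nth)
qed

lemma chart_map_image: "chart_map a ` chart_dom a = UNIV"
  using affine_lift_in_chart_dom chart_map_affine_lift by (metis surjI image_eqI UNIV_eq_I)

lemma inj_on_chart_map: "inj_on (chart_map a) (chart_dom a)"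
  by (metis inj_onI affine_lift_chart_map proj_pt_normalized)

section \<open>Holomorphic curves\<close>

definition curve_fps :: "(complex \<Rightarrow> (complex, 'm::finite) vec) \<Rightarrow> 'm \<Rightarrow> complex fps" where
  "curve_fps g i = fps_expansion (\<lambda>z. g z $ i) 0"

text \<open>From here on, computations with derivatives of curves are computations with formal power
  series.\<close>

lemma deriv_coord_eq: "deriv_coord g = jet_coords (curve_fps g)"
  by (auto simp: deriv_coord_def jet_coords_def curve_fps_def fps_expansion_def)

lemma curve_has_fps_expansion:
  "curve_holomorphic_at_0 g \<Longrightarrow> (\<lambda>z. g z $ i) has_fps_expansion curve_fps g i"
  by (simp add: curve_holomorphic_at_0_def curve_fps_def analytic_at_imp_has_fps_expansion_0)

lemma curve_fps_eqI: "(\<lambda>z. g z $ i) has_fps_expansion F \<Longrightarrow> curve_fps g i = F"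
  by (simp add: curve_fps_def fps_expansion_eqI)

lemma curve_holomorphicI:
  "(\<And>i. (\<lambda>z. g z $ i) has_fps_expansion F i) \<Longrightarrow> curve_holomorphic_at_0 g"
  using has_fps_expansion_imp_analytic_0 by (auto simp: curve_holomorphic_at_0_def)

lemma curve_fps_nth_0 [simp]: "fps_nth (curve_fps g i) 0 = g 0 $ i"
  by (simp add: curve_fps_def fps_expansion_def)

lemma curve_eventually_nonzero:
  assumes "curve_holomorphic_at_0 g" "g 0 $ a \<noteq> 0"
  shows "\<forall>\<^sub>F z in nhds 0. g z $ a \<noteq> 0"
proof -
  have "continuous (at 0) (\<lambda>z. g z $ a)"
    using has_fps_expansion_imp_continuous[OF curve_has_fps_expansion[OF assms(1)]] .
  then have "((\<lambda>z. g z $ a) \<longlongrightarrow> g 0 $ a) (nhds 0)"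
    by (simp add: isCont_def tendsto_nhds_iff)
  then show ?thesis using assms(2) by (rule tendsto_imp_eventually_ne)
qed

lemma hol_germ_proj_atlas:
  "hol_germ proj_atlas \<gamma> \<longleftrightarrow> (\<forall>a. \<gamma> 0 \<in> chart_dom a \<longrightarrow>
     (\<forall>\<^sub>F z in nhds 0. \<gamma> z \<in> chart_dom a) \<and> curve_holomorphic_at_0 (chart_map a \<circ> \<gamma>))"
  by (auto simp: hol_germ_def proj_atlas_def)

text \<open>The Taylor series of the lift of \<open>\<gamma>\<close> normalized by
  \<open>X_a = 1\<close>; all other lifts over this chart are compared with it.\<close>

abbreviation lift_fps :: "'n option \<Rightarrow> (complex \<Rightarrow> 'n::finite proj) \<Rightarrow> 'n option \<Rightarrow> complex fps" where
  "lift_fps a \<gamma> \<equiv> curve_fps (normalized a \<circ> \<gamma>)"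

lemma curve_fps_chart_map: "curve_fps (chart_map a \<circ> \<gamma>) j = lift_fps a \<gamma> (omit a j)"
  by (simp add: curve_fps_def chart_map_nth)

lemma
  assumes "hol_germ proj_atlas \<gamma>" "\<gamma> 0 \<in> chart_dom a"
  shows germ_in_chart: "\<forall>\<^sub>F z in nhds 0. \<gamma> z \<in> chart_dom a"
    and lift_fps_self: "lift_fps a \<gamma> a = 1"
    and lift_has_fps_expansion: "(\<lambda>z. normalized a (\<gamma> z) $ i) has_fps_expansion lift_fps a \<gamma> i"
    and lift_holomorphic: "curve_holomorphic_at_0 (normalized a \<circ> \<gamma>)"
proof -
  show ev: "\<forall>\<^sub>F z in nhds 0. \<gamma> z \<in> chart_dom a"
    using assms by (auto simp: hol_germ_proj_atlas)
  \<comment> \<open>Off \<open>chart_dom a\<close> the value of \<open>normalized\<close> is not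
    controlled, so this coordinate equals 1 only near the origin.\<close>
  have 1: "(\<lambda>z. normalized a (\<gamma> z) $ a) has_fps_expansion 1"
  proof (subst has_fps_expansion_cong)
    show "\<forall>\<^sub>F z in nhds 0. normalized a (\<gamma> z) $ a = 1"
      using ev by eventually_elim (simp add: normalized_nth_self)
  qed auto
  then show *: "lift_fps a \<gamma> a = 1" by (intro curve_fps_eqI) simp
  show **: "(\<lambda>z. normalized a (\<gamma> z) $ i) has_fps_expansion lift_fps a \<gamma> i" for i
  proof (cases rule: omit_cases[of i a])
    case (2 j)
    have "curve_holomorphic_at_0 (chart_map a \<circ> \<gamma>)"
      using assms by (auto simp: hol_germ_proj_atlas)
    from curve_has_fps_expansion[OF this, of j] show ?thesis
      by (simp add: curve_fps_chart_map chart_map_nth 2)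
  qed (use 1 * in auto)
  show "curve_holomorphic_at_0 (normalized a \<circ> \<gamma>)"
    by (rule curve_holomorphicI) (use ** in auto)
qed

text \<open>Dividing a lift by its \<open>a\<close>-th coordinate, a unit near the origin, gives the
  normalized lift. The same quotients show that the affine coordinates of the curve are
  holomorphic.\<close>

lemma
  assumes "curve_holomorphic_at_0 g" "g 0 \<noteq> 0"
  shows hol_germ_proj_pt: "hol_germ proj_atlas (proj_pt \<circ> g)"
    and lift_fps_proj_pt: "g 0 $ a \<noteq> 0 \<Longrightarrow>
      lift_fps a (proj_pt \<circ> g) i = curve_fps g i * inverse (curve_fps g a)"
proof -
  have e: "(\<lambda>z. normalized a (proj_pt (g z)) $ i) has_fps_expansion
      curve_fps g i * inverse (curve_fps g a)" if a: "g 0 $ a \<noteq> 0" for a i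
  proof (subst has_fps_expansion_cong)
    show "\<forall>\<^sub>F z in nhds 0. normalized a (proj_pt (g z)) $ i = g z $ i * inverse (g z $ a)"
      using curve_eventually_nonzero[OF assms(1) a]
      by eventually_elim (simp add: normalized_proj_pt)
    show "(\<lambda>z. g z $ i * inverse (g z $ a)) has_fps_expansion
        curve_fps g i * inverse (curve_fps g a)"
      by (intro fps_expansion_intros curve_has_fps_expansion assms) (use a in simp)
  qed auto
  then show "lift_fps a (proj_pt \<circ> g) i = curve_fps g i * inverse (curve_fps g a)"
    if "g 0 $ a \<noteq> 0"
    using that by (intro curve_fps_eqI) auto
  show "hol_germ proj_atlas (proj_pt \<circ> g)"
    unfolding hol_germ_proj_atlas
  proof safe
    fix a assume "(proj_pt \<circ> g) 0 \<in> chart_dom a"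
    then have a: "g 0 $ a \<noteq> 0" using assms by (simp add: proj_pt_in_chart_dom)
    show "\<forall>\<^sub>F z in nhds 0. (proj_pt \<circ> g) z \<in> chart_dom a"
      using curve_eventually_nonzero[OF assms(1) a]
      by eventually_elim (metis comp_apply proj_pt_in_chart_dom zero_index)
    show "curve_holomorphic_at_0 (chart_map a \<circ> (proj_pt \<circ> g))"
      by (rule curve_holomorphicI) (use e[OF a] in \<open>simp add: chart_map_nth\<close>)
  qed
qed

lemma eventually_proj_pt_normalized:
  assumes "hol_germ proj_atlas \<gamma>" "\<gamma> 0 \<in> chart_dom a"
  shows "\<forall>\<^sub>F z in nhds 0. proj_pt (normalized a (\<gamma> z)) = \<gamma> z"
  using germ_in_chart[OF assms] by eventually_elim (rule proj_pt_normalized)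

lemma lift_fps_cong:
  assumes "\<forall>\<^sub>F z in nhds 0. \<gamma> z = \<delta> z"
  shows "lift_fps a \<gamma> = lift_fps a \<delta>"
proof
  fix i show "lift_fps a \<gamma> i = lift_fps a \<delta> i"
    unfolding curve_fps_def by (rule fps_expansion_cong) (use assms in eventually_elim, simp)
qed

text \<open>The lift normalized in chart \<open>a\<close> is itself a lift, so
  \<open>lift_fps_proj_pt\<close> applies to it in chart \<open>b\<close>. The two normalized lifts
  thus differ by a unit power series.\<close>

lemma lift_fps_change:
  assumes "hol_germ proj_atlas \<gamma>" "\<gamma> 0 \<in> chart_dom a" "\<gamma> 0 \<in> chart_dom b"
  shows "lift_fps b \<gamma> i = lift_fps a \<gamma> i * inverse (lift_fps a \<gamma> b)"
proof -
  have "lift_fps b \<gamma> = lift_fps b (proj_pt \<circ> (normalized a \<circ> \<gamma>))"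
    by (rule lift_fps_cong)
      (use eventually_proj_pt_normalized[OF assms(1,2)] in eventually_elim, simp)
  then show ?thesis
    using assms by (simp add: lift_fps_proj_pt lift_holomorphic normalized_nonzero normalized_nth_nonzero)
qed

section \<open>Jets in projective space\<close>

text \<open>Congruence modulo \<open>T^(k+1)\<close>, that is, equality of
  \<open>k\<close>-jets.\<close>

definition fps_agree :: "nat \<Rightarrow> complex fps \<Rightarrow> complex fps \<Rightarrow> bool" where
  "fps_agree k f g \<longleftrightarrow> (\<forall>m\<le>k. fps_nth f m = fps_nth g m)"

lemma fps_agree_refl [simp]: "fps_agree k f f"
  by (simp add: fps_agree_def)

lemma fps_agree_sym: "fps_agree k f g \<Longrightarrow> fps_agree k g f"
  by (simp add: fps_agree_def)

lemma fps_agree_mult: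
  "fps_agree k f f' \<Longrightarrow> fps_agree k g g' \<Longrightarrow> fps_agree k (f * g) (f' * g')"
  by (auto simp: fps_agree_def fps_mult_nth intro!: sum.cong)

text \<open>Multiply the congruence of \<open>f\<close> and \<open>g\<close> by both inverses;
  \<open>g\<close> is a unit too, having the same constant term as \<open>f\<close>.\<close>

lemma fps_agree_inverse:
  assumes "fps_agree k f g" "fps_nth f 0 \<noteq> 0"
  shows "fps_agree k (inverse f) (inverse g)"
proof -
  have "fps_nth g 0 \<noteq> 0" using assms by (auto simp: fps_agree_def)
  have "fps_agree k (inverse f * (g * inverse g)) (inverse f * (f * inverse g))"
    using assms(1) by (intro fps_agree_mult fps_agree_refl fps_agree_sym[OF assms(1)])
  moreover have "g * inverse g = 1" "f * inverse f = 1"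
    using assms(2) \<open>fps_nth g 0 \<noteq> 0\<close> by (auto intro: inverse_mult_eq_1')
  moreover from this(2) have "inverse f * (f * inverse g) = inverse g"
    by (simp only: mult.assoc[symmetric] mult.commute[of "inverse f" f] mult_1_left)
  ultimately show ?thesis by simp
qed

lemma jet_coords_agree:
  assumes "\<And>i. fps_agree k (u i) (u' i)" "cpoly_vars P \<subseteq> UNIV \<times> {..k}"
  shows "cpoly_eval (jet_coords u) P = cpoly_eval (jet_coords u') P"
  by (rule cpoly_eval_cong) (use assms in \<open>auto simp: fps_agree_def\<close>)

lemma jet_proj_atlas:
  "jet proj_atlas k \<gamma> = {\<delta>. hol_germ proj_atlas \<delta> \<and> \<delta> 0 = \<gamma> 0 \<and>
     (\<forall>a. \<gamma> 0 \<in> chart_dom a \<longrightarrow> (\<forall>j. \<forall>i\<in>{1..k}.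
        deriv_coord (chart_map a \<circ> \<delta>) (j, i) = deriv_coord (chart_map a \<circ> \<gamma>) (j, i)))}"
  by (simp add: jet_def proj_atlas_def)

text \<open>Whether two germs have the same jet can be tested in a single chart.\<close>

lemma jet_altdef:
  assumes "hol_germ proj_atlas \<gamma>" "\<gamma> 0 \<in> chart_dom a"
  shows "jet proj_atlas k \<gamma> = {\<delta>. hol_germ proj_atlas \<delta> \<and> \<delta> 0 = \<gamma> 0 \<and>
     (\<forall>i. fps_agree k (lift_fps a \<delta> i) (lift_fps a \<gamma> i))}"
proof -
  have chart: "(\<forall>j. \<forall>i\<in>{1..k}. deriv_coord (chart_map b \<circ> \<delta>) (j, i) = deriv_coord (chart_map b \<circ> \<gamma>) (j, i))
      \<longleftrightarrow> (\<forall>i. fps_agree k (lift_fps b \<delta> i) (lift_fps b \<gamma> i))" (is "?L = ?R")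
    if \<delta>: "hol_germ proj_atlas \<delta>" "\<delta> 0 = \<gamma> 0" and b: "\<gamma> 0 \<in> chart_dom b" for b \<delta>
  proof
    assume L: ?L
    show ?R
    proof
      fix i show "fps_agree k (lift_fps b \<delta> i) (lift_fps b \<gamma> i)"
      proof (cases rule: omit_cases[of i b])
        case (2 j)
        show ?thesis
          unfolding fps_agree_def
        proof safe
          \<comment> \<open>The jet condition concerns only the orders 1 to \<open>k\<close>; order
            0 is supplied by the equality of the two base points.\<close>
          fix m assume "m \<le> k"
          then show "fps_nth (lift_fps b \<delta> i) m = fps_nth (lift_fps b \<gamma> i) m"
            using L \<delta>(2) by (cases "m = 0") (auto simp: 2 deriv_coord_eq curve_fps_chart_map)
        qed
      qed (use assms \<delta> b in \<open>simp add: lift_fps_self\<close>)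
    qed
  qed (auto simp: deriv_coord_eq curve_fps_chart_map fps_agree_def)
  \<comment> \<open>Passing to chart \<open>b\<close> divides by a unit series, and products and
    inverses respect congruence up to order \<open>k\<close>.\<close>
  have transfer: "\<forall>i. fps_agree k (lift_fps b \<delta> i) (lift_fps b \<gamma> i)"
    if "hol_germ proj_atlas \<delta>" "\<delta> 0 = \<gamma> 0" "\<gamma> 0 \<in> chart_dom b"
      "\<forall>i. fps_agree k (lift_fps a \<delta> i) (lift_fps a \<gamma> i)" for b \<delta>
    using that assms
    by (auto simp: lift_fps_change[of _ a b] normalized_nth_nonzero
        intro!: fps_agree_mult fps_agree_inverse)
  show ?thesis
    unfolding jet_proj_atlas using chart transfer assms(2) by blast
qed

lemma jet_eq_iff:
  assumes "hol_germ proj_atlas \<gamma>" "hol_germ proj_atlas \<delta>" "\<gamma> 0 \<in> chart_dom a"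
  shows "jet proj_atlas k \<gamma> = jet proj_atlas k \<delta> \<longleftrightarrow>
    \<gamma> 0 = \<delta> 0 \<and> (\<forall>i. fps_agree k (lift_fps a \<gamma> i) (lift_fps a \<delta> i))"
proof
  assume "jet proj_atlas k \<gamma> = jet proj_atlas k \<delta>"
  moreover have "\<delta> \<in> jet proj_atlas k \<delta>" using assms(2) by (simp add: jet_def)
  ultimately have "\<delta> \<in> jet proj_atlas k \<gamma>" by simp
  then show "\<gamma> 0 = \<delta> 0 \<and> (\<forall>i. fps_agree k (lift_fps a \<gamma> i) (lift_fps a \<delta> i))"
    using assms(1,3) by (simp add: jet_altdef fps_agree_def)
next
  assume "\<gamma> 0 = \<delta> 0 \<and> (\<forall>i. fps_agree k (lift_fps a \<gamma> i) (lift_fps a \<delta> i))"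
  then show "jet proj_atlas k \<gamma> = jet proj_atlas k \<delta>"
    using assms jet_altdef[of \<gamma> a k] jet_altdef[of \<delta> a k] by (simp add: fps_agree_def)
qed

lemma jet_cong:
  assumes "hol_germ proj_atlas \<gamma>" "hol_germ proj_atlas \<delta>" "\<forall>\<^sub>F z in nhds 0. \<gamma> z = \<delta> z"
  shows "jet proj_atlas k \<gamma> = jet proj_atlas k \<delta>"
proof -
  obtain a where a: "\<gamma> 0 \<in> chart_dom a" using chart_dom_cover by blast
  have "\<gamma> 0 = \<delta> 0" using assms(3) by (rule eventually_nhds_x_imp_x)
  then show ?thesis
    using jet_eq_iff[OF assms(1,2) a] lift_fps_cong[OF assms(3)] by simp
qed

text \<open>This permits replacing a lift by its Taylor polynomial of degree
  \<open>k\<close>.\<close>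

lemma jet_proj_pt_cong:
  assumes "curve_holomorphic_at_0 g" "curve_holomorphic_at_0 h" "g 0 \<noteq> 0"
    and "\<And>i. fps_agree k (curve_fps g i) (curve_fps h i)"
  shows "jet proj_atlas k (proj_pt \<circ> g) = jet proj_atlas k (proj_pt \<circ> h)"
proof -
  have 0: "g 0 = h 0"
    using assms(4) by (force simp: fps_agree_def vec_eq_iff)
  obtain a where a: "g 0 $ a \<noteq> 0" using assms(3) by (auto simp: vec_eq_iff)
  have "fps_agree k (lift_fps a (proj_pt \<circ> g) i) (lift_fps a (proj_pt \<circ> h) i)" for i
    using assms a 0
    by (auto simp: lift_fps_proj_pt intro!: fps_agree_mult fps_agree_inverse)
  moreover have "hol_germ proj_atlas (proj_pt \<circ> g)" "hol_germ proj_atlas (proj_pt \<circ> h)"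
    using assms 0 by (auto intro: hol_germ_proj_pt)
  ultimately show ?thesis
    using jet_eq_iff[of "proj_pt \<circ> g" "proj_pt \<circ> h" a k] a 0 assms(3)
    by (auto simp: proj_pt_in_chart_dom)
qed

section \<open>Reparametrization of curves and the scaling action on jets\<close>

lemma has_fps_expansion_rescale:
  fixes f :: "complex \<Rightarrow> complex"
  assumes "f has_fps_expansion F"
  shows "(\<lambda>z. f (c * z)) has_fps_expansion fps_rescale c F"
proof -
  have "(f \<circ> (\<lambda>z. c * z)) has_fps_expansion fps_compose F (fps_const c * fps_X)"
    by (intro fps_expansion_intros assms) auto
  then show ?thesis
    by (simp add: o_def fps_compose_linear fps_rescale_def)
qed

lemma
  assumes "hol_germ proj_atlas \<gamma>"
  shows hol_germ_rescale: "hol_germ proj_atlas (\<lambda>z. \<gamma> (c * z))"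
    and lift_fps_rescale: "\<gamma> 0 \<in> chart_dom a \<Longrightarrow>
      lift_fps a (\<lambda>z. \<gamma> (c * z)) i = fps_rescale c (lift_fps a \<gamma> i)"
proof -
  have e: "(\<lambda>z. normalized a (\<gamma> (c * z)) $ i) has_fps_expansion fps_rescale c (lift_fps a \<gamma> i)"
    if "\<gamma> 0 \<in> chart_dom a" for a i
    by (rule has_fps_expansion_rescale[OF lift_has_fps_expansion[OF assms that]])
  then show "lift_fps a (\<lambda>z. \<gamma> (c * z)) i = fps_rescale c (lift_fps a \<gamma> i)"
    if "\<gamma> 0 \<in> chart_dom a"
    by (intro curve_fps_eqI) (use that in simp)
  show "hol_germ proj_atlas (\<lambda>z. \<gamma> (c * z))"
    unfolding hol_germ_proj_atlas
  proof safe
    fix a assume "\<gamma> (c * 0) \<in> chart_dom a"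
    then have a: "\<gamma> 0 \<in> chart_dom a" by simp
    have "((\<lambda>z. c * z) \<longlongrightarrow> c * 0) (nhds 0)" by (intro tendsto_mult tendsto_const filterlim_ident)
    then show "\<forall>\<^sub>F z in nhds 0. \<gamma> (c * z) \<in> chart_dom a"
      using germ_in_chart[OF assms a] by (auto simp: filterlim_iff)
    show "curve_holomorphic_at_0 (chart_map a \<circ> (\<lambda>z. \<gamma> (c * z)))"
      by (rule curve_holomorphicI) (use e[OF a] in \<open>simp add: chart_map_nth\<close>)
  qed
qed

text \<open>In every chart, replacing \<open>z\<close> by \<open>c z\<close> multiplies the
  \<open>i\<close>-th derivative at the origin by \<open>c ^ i\<close>, so the action is realized on
  representatives by reparametrization.\<close>

lemma jet_scale_jet:
  assumes "hol_germ proj_atlas \<gamma>"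
  shows "jet_scale proj_atlas k c (jet proj_atlas k \<gamma>) = jet proj_atlas k (\<lambda>z. \<gamma> (c * z))"
proof -
  have d: "deriv_coord (chart_map a \<circ> (\<lambda>z. \<gamma> (c * z))) (j, i) =
      c ^ i * deriv_coord (chart_map a \<circ> \<gamma>) (j, i)" if "\<gamma> 0 \<in> chart_dom a" for a j i
    using lift_fps_rescale[OF assms that]
    by (simp add: deriv_coord_eq curve_fps_chart_map)
  have scale: "jet_scale proj_atlas k c J = {\<delta>. hol_germ proj_atlas \<delta> \<and> (\<exists>\<gamma>\<in>J. \<delta> 0 = \<gamma> 0 \<and>
     (\<forall>a. \<gamma> 0 \<in> chart_dom a \<longrightarrow> (\<forall>j. \<forall>i\<in>{1..k}.
        deriv_coord (chart_map a \<circ> \<delta>) (j, i) = c ^ i * deriv_coord (chart_map a \<circ> \<gamma>) (j, i))))}"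
    for J :: "'a proj jet"
    by (simp add: jet_scale_def proj_atlas_def)
  show ?thesis
  proof (intro set_eqI iffI)
    fix \<delta> assume "\<delta> \<in> jet_scale proj_atlas k c (jet proj_atlas k \<gamma>)"
    then obtain \<gamma>' where "hol_germ proj_atlas \<delta>" "\<gamma>' \<in> jet proj_atlas k \<gamma>" "\<delta> 0 = \<gamma>' 0"
      "\<And>a j i. \<gamma>' 0 \<in> chart_dom a \<Longrightarrow> i \<in> {1..k} \<Longrightarrow>
        deriv_coord (chart_map a \<circ> \<delta>) (j, i) = c ^ i * deriv_coord (chart_map a \<circ> \<gamma>') (j, i)"
      unfolding scale by blast
    then show "\<delta> \<in> jet proj_atlas k (\<lambda>z. \<gamma> (c * z))"
      using d by (simp add: jet_proj_atlas)
  next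
    fix \<delta> assume "\<delta> \<in> jet proj_atlas k (\<lambda>z. \<gamma> (c * z))"
    then show "\<delta> \<in> jet_scale proj_atlas k c (jet proj_atlas k \<gamma>)"
      unfolding scale using d assms by (auto simp: jet_proj_atlas intro!: bexI[of _ \<gamma>])
  qed
qed

section \<open>Polynomials with holomorphic coefficients\<close>

lemma holomorphic_mv_const: "holomorphic_mv (\<lambda>_. c) S"
  unfolding holomorphic_mv_def by (intro ballI exI[of _ "\<lambda>_. 0"]) simp

lemma holomorphic_mv_nth: "holomorphic_mv (\<lambda>z. z $ j) S"
  unfolding holomorphic_mv_def
  by (intro ballI exI[of _ "\<lambda>w. w $ j"])
    (auto intro: bounded_linear_imp_has_derivative bounded_linear_vec_nth)

lemma holomorphic_mv_add:
  assumes "holomorphic_mv f S" "holomorphic_mv g S"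
  shows "holomorphic_mv (\<lambda>z. f z + g z) S"
  unfolding holomorphic_mv_def
proof
  fix z assume "z \<in> S"
  with assms obtain D E where "(f has_derivative D) (at z)" "(g has_derivative E) (at z)"
    "\<And>c w. D (c *s w) = c * D w" "\<And>c w. E (c *s w) = c * E w"
    unfolding holomorphic_mv_def by metis
  then show "\<exists>D. ((\<lambda>z. f z + g z) has_derivative D) (at z) \<and> (\<forall>c w. D (c *s w) = c * D w)"
    by (intro exI[of _ "\<lambda>w. D w + E w"]) (auto intro: has_derivative_add simp: algebra_simps)
qed

lemma holomorphic_mv_mult:
  assumes "holomorphic_mv f S" "holomorphic_mv g S"
  shows "holomorphic_mv (\<lambda>z. f z * g z) S"
  unfolding holomorphic_mv_def
proof
  fix z assume "z \<in> S"
  with assms obtain D E where "(f has_derivative D) (at z)" "(g has_derivative E) (at z)"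
    "\<And>c w. D (c *s w) = c * D w" "\<And>c w. E (c *s w) = c * E w"
    unfolding holomorphic_mv_def by metis
  then show "\<exists>D. ((\<lambda>z. f z * g z) has_derivative D) (at z) \<and> (\<forall>c w. D (c *s w) = c * D w)"
    by (intro exI[of _ "\<lambda>w. f z * E w + D w * g z"] conjI has_derivative_mult)
      (auto simp: algebra_simps)
qed

text \<open>Generating these families from fixed monomials with holomorphic coefficients makes
  closure under products an induction, with no convolution of coefficients to handle.\<close>

inductive hol_family :: "((complex, 'n::finite) vec \<Rightarrow> 'v cpoly) \<Rightarrow> bool" where
  zero: "hol_family (\<lambda>_. 0)"
| single: "holomorphic_mv c UNIV \<Longrightarrow> hol_family (\<lambda>z. Poly_Mapping.single m (c z))"
| add: "hol_family f \<Longrightarrow> hol_family g \<Longrightarrow> hol_family (\<lambda>z. f z + g z)"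

lemma hol_family_lookup:
  "hol_family f \<Longrightarrow> holomorphic_mv (\<lambda>z. Poly_Mapping.lookup (f z) m) UNIV"
proof (induction rule: hol_family.induct)
  case (single c m')
  then show ?case by (cases "m' = m") (auto simp: lookup_single when_def holomorphic_mv_const)
qed (auto simp: lookup_add holomorphic_mv_const holomorphic_mv_add)

lemma hol_family_mult:
  assumes "hol_family f" "hol_family g"
  shows "hol_family (\<lambda>z. f z * g z)"
  using assms(1)
proof (induction rule: hol_family.induct)
  case (single c m)
  show ?case
    using assms(2)
  proof (induction rule: hol_family.induct)
    case (single c' m')
    with \<open>holomorphic_mv c UNIV\<close> show ?case
      by (simp add: mult_single hol_family.single holomorphic_mv_mult)
  qed (auto simp: algebra_simps intro: hol_family.intros)
qed (auto simp: algebra_simps intro: hol_family.intros)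

lemma hol_family_const: "holomorphic_mv c UNIV \<Longrightarrow> hol_family (\<lambda>z. cpoly_const (c z))"
  unfolding cpoly_const_def by (rule hol_family.single)

lemma hol_family_var: "hol_family (\<lambda>_. cpoly_var v)"
  unfolding cpoly_var_def by (intro hol_family.single holomorphic_mv_const)

lemma hol_family_1: "hol_family (\<lambda>_. 1)"
  using hol_family_const[OF holomorphic_mv_const[of 1]] by (simp add: cpoly_const_def)

lemma hol_family_power: "hol_family f \<Longrightarrow> hol_family (\<lambda>z. f z ^ n)"
  by (induction n) (auto intro: hol_family_1 hol_family_mult)

lemma hol_family_prod:
  "(\<And>i. i \<in> I \<Longrightarrow> hol_family (f i)) \<Longrightarrow> hol_family (\<lambda>z. \<Prod>i\<in>I. f i z)"
  by (induction I rule: infinite_finite_induct) (auto intro: hol_family_1 hol_family_mult)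

lemma hol_family_sum:
  "(\<And>i. i \<in> I \<Longrightarrow> hol_family (f i)) \<Longrightarrow> hol_family (\<lambda>z. \<Sum>i\<in>I. f i z)"
  by (induction I rule: infinite_finite_induct) (auto intro: hol_family.intros)

lemma hol_family_subst:
  assumes "\<And>v. hol_family (\<lambda>z. g z v)"
  shows "hol_family (\<lambda>z. cpoly_subst cpoly_const (g z) P)"
  unfolding cpoly_subst_def
  by (intro hol_family_sum hol_family_mult hol_family_prod hol_family_power assms
      hol_family_const holomorphic_mv_const)

lemma cpoly_vars_const [simp]: "cpoly_vars (cpoly_const c) = {}"
  by (auto simp: cpoly_vars_def cpoly_const_def)

lemma cpoly_vars_var [simp]: "cpoly_vars (cpoly_var v) = {v}"
  by (auto simp: cpoly_vars_def cpoly_var_def)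

lemma cpoly_vars_mult: "cpoly_vars (P * Q) \<subseteq> cpoly_vars P \<union> cpoly_vars Q"
proof
  fix v assume "v \<in> cpoly_vars (P * Q)"
  then obtain m where "m \<in> Poly_Mapping.keys (P * Q)" "v \<in> Poly_Mapping.keys m"
    by (auto simp: cpoly_vars_def)
  moreover obtain m1 m2 where "m = m1 + m2" "m1 \<in> Poly_Mapping.keys P" "m2 \<in> Poly_Mapping.keys Q"
    using keys_mult[of P Q] calculation(1) by blast
  ultimately show "v \<in> cpoly_vars P \<union> cpoly_vars Q"
    using keys_add[of m1 m2] by (auto simp: cpoly_vars_def)
qed

lemma cpoly_vars_sum: "(\<And>i. i \<in> I \<Longrightarrow> cpoly_vars (f i) \<subseteq> A) \<Longrightarrow> cpoly_vars (sum f I) \<subseteq> A"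
  by (induction I rule: infinite_finite_induct) (use cpoly_vars_add in fastforce)+

lemma cpoly_vars_1 [simp]: "cpoly_vars 1 = {}"
  using cpoly_vars_const[of 1] by (simp add: cpoly_const_def)

lemma cpoly_vars_power: "cpoly_vars P \<subseteq> A \<Longrightarrow> cpoly_vars (P ^ n) \<subseteq> A"
  by (induction n) (use cpoly_vars_mult in fastforce)+

lemma cpoly_vars_prod: "(\<And>i. i \<in> I \<Longrightarrow> cpoly_vars (f i) \<subseteq> A) \<Longrightarrow> cpoly_vars (prod f I) \<subseteq> A"
  by (induction I rule: infinite_finite_induct) (use cpoly_vars_mult in fastforce)+

lemma cpoly_vars_subst:
  assumes "\<And>v. v \<in> cpoly_vars P \<Longrightarrow> cpoly_vars (g v) \<subseteq> A"
  shows "cpoly_vars (cpoly_subst cpoly_const g P) \<subseteq> A"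
  unfolding cpoly_subst_def
proof (rule cpoly_vars_sum)
  fix m assume m: "m \<in> Poly_Mapping.keys P"
  have "cpoly_vars (\<Prod>v\<in>Poly_Mapping.keys m. g v ^ Poly_Mapping.lookup m v) \<subseteq> A"
    using m assms by (intro cpoly_vars_prod cpoly_vars_power) (auto simp: cpoly_vars_def)
  then show "cpoly_vars (cpoly_const (Poly_Mapping.lookup P m) *
      (\<Prod>v\<in>Poly_Mapping.keys m. g v ^ Poly_Mapping.lookup m v)) \<subseteq> A"
    using cpoly_vars_mult by fastforce
qed

text \<open>The expression of \<open>P\<close> in the chart \<open>X\<^sub>a \<noteq> 0\<close>: put \<open>X\<^sub>a = 1\<close> and \<open>X\<^sub>a\<^sup>(\<^sup>m\<^sup>) = 0\<close> for \<open>m > 0\<close>.\<close>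

definition chart_poly ::
  "'n option \<Rightarrow> 'n::finite option diffpoly \<Rightarrow> (complex, 'n) vec \<Rightarrow> ('n \<times> nat) cpoly" where
  "chart_poly a P z = cpoly_subst cpoly_const
     (\<lambda>(i, m). if m = 0 then cpoly_const (affine_lift a z $ i)
        else if i = a then 0 else cpoly_var (inv (omit a) i, m)) P"

lemma hol_family_chart_poly: "hol_family (chart_poly a P)"
proof -
  have "holomorphic_mv (\<lambda>z. affine_lift a z $ i) UNIV" for i
    by (cases "i = a") (auto simp: affine_lift_def holomorphic_mv_const holomorphic_mv_nth)
  then have "hol_family (\<lambda>z. if m = 0 then cpoly_const (affine_lift a z $ i)
      else if i = a then 0 else cpoly_var (inv (omit a) i, m))" for i m
    by (cases "m = 0"; cases "i = a") (auto intro: hol_family_const hol_family_var hol_family.zero holomorphic_mv_const)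
  then show ?thesis
    unfolding chart_poly_def split_beta by (intro hol_family_subst)
qed

lemma cpoly_vars_chart_poly:
  assumes "cpoly_vars P \<subseteq> UNIV \<times> {..k}"
  shows "cpoly_vars (chart_poly a P z) \<subseteq> UNIV \<times> {1..k}"
  unfolding chart_poly_def using assms by (intro cpoly_vars_subst) (auto split: if_splits)

text \<open>The lift normalized in chart \<open>a\<close> has constant \<open>a\<close>-th
  coordinate 1, and its other coordinates are the affine ones; \<open>chart_poly\<close> performs
  exactly this substitution, with the base point as parameter.\<close>

lemma cpoly_eval_chart_poly:
  assumes "hol_germ proj_atlas \<gamma>" "\<gamma> 0 \<in> chart_dom a"
  shows "cpoly_eval (deriv_coord (chart_map a \<circ> \<gamma>)) (chart_poly a P (chart_map a (\<gamma> 0))) =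
    cpoly_eval (jet_coords (lift_fps a \<gamma>)) P"
  unfolding chart_poly_def
proof (subst cpoly_eval_subst, simp, rule cpoly_eval_cong, safe)
  fix i m
  show "cpoly_eval (deriv_coord (chart_map a \<circ> \<gamma>))
      (if m = 0 then cpoly_const (affine_lift a (chart_map a (\<gamma> 0)) $ i)
       else if i = a then 0 else cpoly_var (inv (omit a) i, m)) =
    jet_coords (lift_fps a \<gamma>) (i, m)"
    using assms
    by (cases rule: omit_cases[of i a])
      (auto simp: affine_lift_chart_map normalized_nth_self lift_fps_self deriv_coord_eq
        curve_fps_chart_map inv_f_f[OF inj_omit])
qed

section \<open>The section defined by a differentially homogeneous polynomial\<close>

text \<open>Germ and chart are chosen arbitrarily; \<open>jet_section_eq\<close> proves independence
  of both. The factor \<open>(v $ a) ^ d\<close> accounts for passing from the normalized lift to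
  the lift through \<open>v\<close>.\<close>

definition jet_section ::
  "nat \<Rightarrow> nat \<Rightarrow> 'n::finite option diffpoly \<Rightarrow> 'n proj \<Rightarrow> 'n twisted" where
  "jet_section k d P x J v = (if J \<in> jets_at proj_atlas k x \<and> v \<in> line_of x then
     (let \<gamma> = SOME \<gamma>. hol_germ proj_atlas \<gamma> \<and> \<gamma> 0 = x \<and> J = jet proj_atlas k \<gamma>;
          a = SOME a. x \<in> chart_dom a
      in cpoly_eval (jet_coords (lift_fps a \<gamma>)) P * (v $ a) ^ d) else 0)"

lemma jet_section_add: "jet_section k d (P + Q) = jet_section k d P + jet_section k d Q"
  by (intro ext) (simp add: jet_section_def Let_def algebra_simps)

lemma jet_section_scale: "jet_section k d (cpoly_scale c P) x J v = c * jet_section k d P x J v"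
  by (simp add: jet_section_def Let_def)

lemma jet_section_0 [simp]: "jet_section k d 0 = 0"
  by (intro ext) (simp add: jet_section_def Let_def)

lemma jet_section_sum: "jet_section k d (sum f I) x J v = (\<Sum>i\<in>I. jet_section k d (f i) x J v)"
  by (induction I rule: infinite_finite_induct) (auto simp: jet_section_add)

lemma jet_section_eq_0: "J \<notin> jets_at proj_atlas k x \<or> v \<notin> line_of x \<Longrightarrow> jet_section k d P x J v = 0"
  by (auto simp: jet_section_def)

text \<open>Germs with the same jet have normalized lifts that agree up to order \<open>k\<close>,
  which \<open>P\<close> cannot tell apart. A change of chart multiplies the lift by a unit
  \<open>q\<close>, and the resulting power of its constant term is cancelled by the change from
  \<open>v $ b\<close> to \<open>v $ a\<close>.\<close>

lemma jet_section_eq: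
  assumes P: "P \<in> V_diff d k" and \<gamma>: "hol_germ proj_atlas \<gamma>"
    and a: "\<gamma> 0 \<in> chart_dom a" and v: "v \<in> line_of (\<gamma> 0)"
  shows "jet_section k d P (\<gamma> 0) (jet proj_atlas k \<gamma>) v =
    cpoly_eval (jet_coords (lift_fps a \<gamma>)) P * (v $ a) ^ d"
proof -
  define \<delta> where "\<delta> = (SOME \<delta>. hol_germ proj_atlas \<delta> \<and> \<delta> 0 = \<gamma> 0 \<and>
    jet proj_atlas k \<gamma> = jet proj_atlas k \<delta>)"
  define b where "b = (SOME b. \<gamma> 0 \<in> chart_dom b)"
  have b: "\<gamma> 0 \<in> chart_dom b" unfolding b_def using a by (rule someI)
  have "hol_germ proj_atlas \<delta> \<and> \<delta> 0 = \<gamma> 0 \<and> jet proj_atlas k \<gamma> = jet proj_atlas k \<delta>"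
    unfolding \<delta>_def by (rule someI[of _ \<gamma>]) (use \<gamma> in simp)
  then have agree: "fps_agree k (lift_fps b \<delta> i) (lift_fps b \<gamma> i)" for i
    using jet_eq_iff[OF \<gamma> _ b, of \<delta> k] by (auto intro: fps_agree_sym)
  have vars: "cpoly_vars P \<subseteq> UNIV \<times> {..k}" and hom: "jet_homogeneous d P"
    using P by (auto simp: V_diff_altdef)
  define q where "q = inverse (lift_fps a \<gamma> b)"
  have n: "normalized a (\<gamma> 0) $ b \<noteq> 0" using a b by (rule normalized_nth_nonzero)
  have "cpoly_eval (jet_coords (lift_fps b \<delta>)) P = cpoly_eval (jet_coords (lift_fps b \<gamma>)) P"
    by (rule jet_coords_agree[OF agree vars])
  also have "lift_fps b \<gamma> = (\<lambda>i. q * lift_fps a \<gamma> i)"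
    by (simp add: fun_eq_iff lift_fps_change[OF \<gamma> a b] q_def mult.commute)
  also have "cpoly_eval (jet_coords \<dots>) P = fps_nth q 0 ^ d * cpoly_eval (jet_coords (lift_fps a \<gamma>)) P"
    using hom by (simp add: jet_homogeneous_def)
  finally have E: "cpoly_eval (jet_coords (lift_fps b \<delta>)) P =
      inverse (normalized a (\<gamma> 0) $ b) ^ d * cpoly_eval (jet_coords (lift_fps a \<gamma>)) P"
    using n by (simp add: q_def o_def)
  have "v $ b = v $ a * normalized a (\<gamma> 0) $ b"
    using arg_cong[OF line_of_normalized[OF v a], of "\<lambda>v. v $ b"] by simp
  moreover have "jet proj_atlas k \<gamma> \<in> jets_at proj_atlas k (\<gamma> 0)"
    using \<gamma> by (auto simp: jets_at_def)
  ultimately show ?thesis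
    using v n E by (simp add: jet_section_def Let_def flip: \<delta>_def b_def)
      (simp add: power_mult_distrib field_simps)
qed

text \<open>The normalized lift is \<open>g\<close> times the inverse of its \<open>a\<close>-th
  coordinate; homogeneity of \<open>P\<close> produces a factor that cancels against
  \<open>(g 0 $ a) ^ d\<close>.\<close>

lemma jet_section_curve:
  assumes P: "P \<in> V_diff d k" and g: "curve_holomorphic_at_0 g" "g 0 \<noteq> 0"
  shows "jet_section k d P (proj_pt (g 0)) (jet proj_atlas k (proj_pt \<circ> g)) (g 0) =
    cpoly_eval (deriv_coord g) P"
proof -
  obtain a where a: "g 0 $ a \<noteq> 0" using g(2) by (auto simp: vec_eq_iff)
  define q where "q = inverse (curve_fps g a)"
  have "jet_section k d P (proj_pt (g 0)) (jet proj_atlas k (proj_pt \<circ> g)) (g 0) =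
      cpoly_eval (jet_coords (lift_fps a (proj_pt \<circ> g))) P * (g 0 $ a) ^ d"
    using jet_section_eq[OF P hol_germ_proj_pt[OF g], of a "g 0"] g a
    by (simp add: proj_pt_in_chart_dom in_line_of_proj_pt)
  also have "lift_fps a (proj_pt \<circ> g) = (\<lambda>i. q * curve_fps g i)"
    by (simp add: fun_eq_iff lift_fps_proj_pt[OF g a] q_def mult.commute)
  also have "cpoly_eval (jet_coords \<dots>) P = fps_nth q 0 ^ d * cpoly_eval (jet_coords (curve_fps g)) P"
    using P by (simp add: V_diff_altdef jet_homogeneous_def)
  finally show ?thesis
    using a by (simp add: q_def deriv_coord_eq o_def field_simps flip: power_mult_distrib)
qed

lemma jets_atE:
  assumes "J \<in> jets_at proj_atlas k x"
  obtains \<gamma> where "hol_germ proj_atlas \<gamma>" "\<gamma> 0 = x" "J = jet proj_atlas k \<gamma>"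
  using assms by (auto simp: jets_at_def)

lemma jet_section_O_fiber:
  assumes "P \<in> V_diff d k"
  shows "jet_section k d P x J \<in> O_fiber d x"
  unfolding O_fiber_def
proof safe
  fix v c assume v: "v \<in> line_of x"
  show "jet_section k d P x J (c *s v) = c ^ d * jet_section k d P x J v"
  proof (cases "J \<in> jets_at proj_atlas k x")
    case True
    then obtain \<gamma> where "hol_germ proj_atlas \<gamma>" "\<gamma> 0 = x" "J = jet proj_atlas k \<gamma>"
      by (rule jets_atE)
    moreover obtain a where "x \<in> chart_dom a" using chart_dom_cover by blast
    ultimately show ?thesis
      using v line_of_scale[OF v, of c] jet_section_eq[OF assms, of \<gamma> a]
      by (auto simp: power_mult_distrib)
  qed (simp add: jet_section_eq_0)
qed (simp add: jet_section_eq_0)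

lemma jet_section_GG_fiber:
  assumes P: "P \<in> V_diff d k"
    and w: "\<And>c x. cpoly_eval (\<lambda>v. c ^ snd v * x v) P = c ^ n * cpoly_eval x P"
  shows "(\<lambda>J. jet_section k d P x J v) \<in> GG_fiber proj_atlas k n x"
proof (cases "v \<in> line_of x")
  case True
  have "\<exists>p. cpoly_vars p \<subseteq> UNIV \<times> {1..k} \<and> (\<forall>\<gamma>. hol_germ proj_atlas \<gamma> \<and> \<gamma> 0 = x \<longrightarrow>
      jet_section k d P x (jet proj_atlas k \<gamma>) v = cpoly_eval (deriv_coord (chart_map a \<circ> \<gamma>)) p)"
    if a: "x \<in> chart_dom a" for a
  proof (intro exI[of _ "cpoly_scale (v $ a ^ d) (chart_poly a P (chart_map a x))"] conjI allI impI)
    show "cpoly_vars (cpoly_scale (v $ a ^ d) (chart_poly a P (chart_map a x))) \<subseteq> UNIV \<times> {1..k}"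
      using P by (intro order.trans[OF cpoly_vars_scale cpoly_vars_chart_poly])
        (auto simp: V_diff_altdef)
    fix \<gamma> assume "hol_germ proj_atlas \<gamma> \<and> \<gamma> 0 = x"
    then show "jet_section k d P x (jet proj_atlas k \<gamma>) v =
        cpoly_eval (deriv_coord (chart_map a \<circ> \<gamma>))
          (cpoly_scale (v $ a ^ d) (chart_poly a P (chart_map a x)))"
      using jet_section_eq[OF P, of \<gamma> a v] cpoly_eval_chart_poly[of \<gamma> a P] a True by auto
  qed
  moreover have "jet_section k d P x (jet_scale proj_atlas k c J) v = c ^ n * jet_section k d P x J v"
    if "J \<in> jets_at proj_atlas k x" for J c
  proof -
    from that obtain \<gamma> where \<gamma>: "hol_germ proj_atlas \<gamma>" "\<gamma> 0 = x" "J = jet proj_atlas k \<gamma>"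
      by (rule jets_atE)
    obtain a where a: "x \<in> chart_dom a" using chart_dom_cover by blast
    have "lift_fps a (\<lambda>z. \<gamma> (c * z)) = (\<lambda>i. fps_rescale c (lift_fps a \<gamma> i))"
      using lift_fps_rescale[OF \<gamma>(1)] \<gamma> a by auto
    then show ?thesis
      using jet_section_eq[OF P, of "\<lambda>z. \<gamma> (c * z)" a v] jet_section_eq[OF P, of \<gamma> a v] \<gamma> a True
      by (simp add: jet_scale_jet hol_germ_rescale jet_coords_rescale w)
  qed
  ultimately show ?thesis
    by (auto simp: GG_fiber_def jet_section_eq_0 proj_atlas_def)
next
  case False
  then show ?thesis
    by (auto simp: GG_fiber_def jet_section_eq_0 intro!: exI[of _ 0])
qed

lemma jet_section_GG_sections:
  assumes P: "P \<in> V_diff d k"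
    and w: "\<And>c x. cpoly_eval (\<lambda>v. c ^ snd v * x v) P = c ^ n * cpoly_eval x P"
  shows "jet_section k d P \<in> GG_sections k n d"
proof -
  have "\<exists>p. (\<forall>x\<in>chart_dom a. cpoly_vars (p x) \<subseteq> UNIV \<times> {1..k} \<and>
       (\<forall>\<gamma>. hol_germ proj_atlas \<gamma> \<and> \<gamma> 0 = x \<longrightarrow>
          (\<forall>v\<in>line_of x. jet_section k d P x (jet proj_atlas k \<gamma>) v =
             cpoly_eval (deriv_coord (chart_map a \<circ> \<gamma>)) (p x) * (v $ a) ^ d))) \<and>
    (\<forall>m. holomorphic_mv
       (\<lambda>z. Poly_Mapping.lookup (p (inv_into (chart_dom a) (chart_map a) z)) m)
       (chart_map a ` chart_dom a))" for a
  proof (intro exI[of _ "\<lambda>x. chart_poly a P (chart_map a x)"] conjI ballI allI impI)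
    fix x show "cpoly_vars (chart_poly a P (chart_map a x)) \<subseteq> UNIV \<times> {1..k}"
      using P by (intro cpoly_vars_chart_poly) (auto simp: V_diff_altdef)
  next
    fix x \<gamma> v assume "x \<in> chart_dom a" "hol_germ proj_atlas \<gamma> \<and> \<gamma> 0 = x" "v \<in> line_of x"
    then show "jet_section k d P x (jet proj_atlas k \<gamma>) v =
        cpoly_eval (deriv_coord (chart_map a \<circ> \<gamma>)) (chart_poly a P (chart_map a x)) * (v $ a) ^ d"
      using jet_section_eq[OF P, of \<gamma> a v] cpoly_eval_chart_poly[of \<gamma> a P] by auto
  next
    fix m
    show "holomorphic_mv (\<lambda>z. Poly_Mapping.lookup
        (chart_poly a P (chart_map a (inv_into (chart_dom a) (chart_map a) z))) m)
        (chart_map a ` chart_dom a)"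
      using hol_family_lookup[OF hol_family_chart_poly]
      by (simp add: chart_map_image f_inv_into_f[of _ "chart_map a" "chart_dom a"])
  qed
  then show ?thesis
    using jet_section_O_fiber[OF P] jet_section_GG_fiber[OF P w]
    by (simp add: GG_sections_def twisted_fiber_def)
qed

definition diff_section :: "nat \<Rightarrow> nat \<Rightarrow> 'n::finite option diffpoly \<Rightarrow> 'n graded_section" where
  "diff_section k d P n = jet_section k d (weight_comp snd n P)"

lemma diff_section_H0:
  assumes "P \<in> V_diff d k"
  shows "diff_section k d P \<in> H0_GG k d"
proof -
  have "diff_section k d P n \<in> GG_sections k n d" for n
    unfolding diff_section_def using assms
    by (intro jet_section_GG_sections V_diff_weight_comp cpoly_eval_scale_weight_comp)
  \<comment> \<open>Only the weights of monomials of \<open>P\<close> contribute, so the whole chart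
    serves as the neighbourhood.\<close>
  moreover have "finite {n. \<exists>y\<in>chart_dom a. chart_map a y \<in> UNIV \<and> diff_section k d P n y \<noteq> 0}" for a
  proof (rule finite_subset)
    show "{n. \<exists>y\<in>chart_dom a. chart_map a y \<in> UNIV \<and> diff_section k d P n y \<noteq> 0} \<subseteq>
        mon_weight snd ` Poly_Mapping.keys P"
      using weight_comp_eq_0[of _ snd P] by (force simp: diff_section_def)
  qed simp
  ultimately show ?thesis
    unfolding H0_GG_def using chart_dom_cover by blast
qed

lemma section_value_diff_section:
  "section_value (diff_section k d P) x J v = jet_section k d P x J v"
proof -
  let ?N = "mon_weight snd ` Poly_Mapping.keys P"
  have "section_value (diff_section k d P) x J v = (\<Sum>n\<in>?N. diff_section k d P n x J v)"
    unfolding section_value_def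
    using weight_comp_eq_0[of _ snd P] by (intro sum.mono_neutral_left) (force simp: diff_section_def)+
  also have "\<dots> = jet_section k d (\<Sum>n\<in>?N. weight_comp snd n P) x J v"
    by (simp add: jet_section_sum diff_section_def)
  also have "\<dots> = jet_section k d P x J v"
    by (simp add: sum_weight_comp)
  finally show ?thesis .
qed

section \<open>Separately polynomial functions\<close>

lemma lagrange_interpolation:
  fixes q :: "complex poly"
  assumes A: "finite A" "degree q < card A"
  shows "poly q t = (\<Sum>a\<in>A. poly q a * (\<Prod>b\<in>A - {a}. (t - b) / (a - b)))"
proof -
  define L where "L a = (\<Prod>b\<in>A - {a}. smult (1 / (a - b)) [:- b, 1:])" for a
  have L: "poly (L a) t = (\<Prod>b\<in>A - {a}. (t - b) / (a - b))" for a t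
    by (simp add: L_def poly_prod diff_divide_distrib)
  have deg: "degree (L a) < card A" if "a \<in> A" for a
  proof -
    have "degree (L a) \<le> (\<Sum>b\<in>A - {a}. degree (smult (1 / (a - b)) [:- b, 1:]))"
      unfolding L_def by (rule order.trans[OF degree_prod_sum_le]) (use A(1) in \<open>simp_all only: o_def finite_Diff order.refl\<close>)
    also have "\<dots> \<le> (\<Sum>b\<in>A - {a}. 1)"
      by (intro sum_mono) simp
    also have "\<dots> = card A - 1" using that A by simp
    finally show ?thesis using that A(1) card_gt_0_iff[of A] by auto
  qed
  have "q = (\<Sum>a\<in>A. smult (poly q a) (L a))"
  proof (rule poly_eqI_degree)
    fix x assume x: "x \<in> A"
    have "poly (L a) x = (if a = x then 1 else 0)" if "a \<in> A" for a
      using x A(1) by (auto simp: L intro!: prod.neutral prod_zero)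
    then have "poly (\<Sum>a\<in>A. smult (poly q a) (L a)) x = (\<Sum>a\<in>A. if a = x then poly q a else 0)"
      by (auto simp: poly_sum intro!: sum.cong)
    then show "poly q x = poly (\<Sum>a\<in>A. smult (poly q a) (L a)) x"
      using x A(1) by simp
  next
    show "degree (\<Sum>a\<in>A. smult (poly q a) (L a)) < card A"
      using A deg by (intro degree_sum_less) (auto intro: le_less_trans[OF degree_smult_le])
  qed (use A in auto)
  then have "poly q t = poly (\<Sum>a\<in>A. smult (poly q a) (L a)) t" by simp
  then show ?thesis by (simp add: poly_sum L)
qed

definition lagrange_cpoly :: "complex set \<Rightarrow> 'v \<Rightarrow> complex \<Rightarrow> 'v cpoly" where
  "lagrange_cpoly A v a =
     (\<Prod>b\<in>A - {a}. cpoly_scale (1 / (a - b)) (cpoly_var v + cpoly_const (- b)))"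

lemma cpoly_eval_lagrange:
  "cpoly_eval x (lagrange_cpoly A v a) = (\<Prod>b\<in>A - {a}. (x v - b) / (a - b))"
  by (simp add: lagrange_cpoly_def)

lemma cpoly_vars_lagrange: "cpoly_vars (lagrange_cpoly A v a) \<subseteq> {v}"
  unfolding lagrange_cpoly_def
proof (rule cpoly_vars_prod)
  fix b
  have "cpoly_vars (cpoly_var v + cpoly_const (- b)) \<subseteq> {v}"
    using cpoly_vars_add[of "cpoly_var v" "cpoly_const (- b)"] by simp
  then show "cpoly_vars (cpoly_scale (1 / (a - b)) (cpoly_var v + cpoly_const (- b))) \<subseteq> {v}"
    using cpoly_vars_scale by (rule order.trans[rotated])
qed

text \<open>The set of nodes is left free so that it can later be chosen away from 0, where slices
  of the function may be out of control.\<close>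

lemma cpoly_interpolation:
  fixes f :: "('v \<Rightarrow> complex) \<Rightarrow> complex"
  assumes A: "finite A" "degree q < card A"
    and q: "\<And>t. f (x(v := t)) = poly q t"
    and p: "\<And>a. a \<in> A \<Longrightarrow> f (x(v := a)) = cpoly_eval x (p a)"
  shows "f x = cpoly_eval x (\<Sum>a\<in>A. p a * lagrange_cpoly A v a)"
proof -
  have "f x = poly q (x v)" using q[of "x v"] by simp
  also have "\<dots> = (\<Sum>a\<in>A. poly q a * (\<Prod>b\<in>A - {a}. (x v - b) / (a - b)))"
    by (rule lagrange_interpolation[OF A])
  also have "\<dots> = cpoly_eval x (\<Sum>a\<in>A. p a * lagrange_cpoly A v a)"
    using p by (auto simp: cpoly_eval_lagrange q intro!: sum.cong)
  finally show ?thesis .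
qed

text \<open>Induction on the variables: fixing \<open>v\<close> at each of \<open>D + 1\<close>
  nodes gives polynomials in the remaining ones, and Lagrange interpolation in \<open>v\<close>
  assembles them. The uniform bound \<open>D\<close> allows the same nodes for all
  \<open>x\<close>.\<close>

lemma separately_polynomial_imp_cpoly:
  fixes f :: "('v \<Rightarrow> complex) \<Rightarrow> complex"
  assumes "finite V"
    and "\<And>v x. v \<in> V \<Longrightarrow> \<exists>q. degree q \<le> D \<and> (\<forall>t. f (x(v := t)) = poly q t)"
    and "\<And>x y. (\<And>v. v \<in> V \<Longrightarrow> x v = y v) \<Longrightarrow> f x = f y"
  shows "\<exists>p. cpoly_vars p \<subseteq> V \<and> (\<forall>x. f x = cpoly_eval x p)"
  using assms
proof (induction V arbitrary: f)
  case empty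
  have "f x = f (\<lambda>_. 0)" for x by (rule empty.prems) auto
  then show ?case by (intro exI[of _ "cpoly_const (f (\<lambda>_. 0))"]) simp
next
  case (insert v V)
  define A :: "complex set" where "A = of_nat ` {..D}"
  have A: "finite A" "card A = D + 1"
    by (auto simp: A_def card_image inj_on_def)
  have "\<exists>p. cpoly_vars p \<subseteq> V \<and> (\<forall>x. f (x(v := a)) = cpoly_eval x p)" for a
  proof (rule insert.IH)
    fix u x assume u: "u \<in> V"
    then have "u \<noteq> v" using insert.hyps by auto
    then show "\<exists>q. degree q \<le> D \<and> (\<forall>t. f ((x(u := t))(v := a)) = poly q t)"
      using insert.prems(1)[of u "x(v := a)"] u by (simp only: fun_upd_twist[OF \<open>u \<noteq> v\<close>] insert_iff simp_thms)
  next
    fix x y assume "\<And>u. u \<in> V \<Longrightarrow> x u = (y u :: complex)"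
    then show "f (x(v := a)) = f (y(v := a))" by (intro insert.prems) auto
  qed
  then obtain p where p: "\<And>a. cpoly_vars (p a) \<subseteq> V" "\<And>a x. f (x(v := a)) = cpoly_eval x (p a)"
    by metis
  have "cpoly_vars (\<Sum>a\<in>A. p a * lagrange_cpoly A v a) \<subseteq> insert v V"
    using p(1) cpoly_vars_lagrange[of A v] cpoly_vars_mult by (intro cpoly_vars_sum) fast
  moreover have "f x = cpoly_eval x (\<Sum>a\<in>A. p a * lagrange_cpoly A v a)" for x
  proof -
    obtain q where "degree q \<le> D" "\<And>t. f (x(v := t)) = poly q t"
      using insert.prems(1)[of v x] by blast
    then show ?thesis using A by (intro cpoly_interpolation[of A q f, OF _ _ _ p(2)]) simp_all
  qed
  ultimately show ?case by blast
qed

text \<open>Liouville's theorem, the growth being read off from the behaviour of \<open>f\<close> near infinity in the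
  coordinate \<open>\<mu>\<close> with \<open>\<mu>\<^sup>w = 1 / t\<close>.\<close>

lemma entire_imp_polynomial:
  assumes f: "f holomorphic_on UNIV" and h: "continuous_on UNIV h" and w: "w > 0"
    and fh: "\<And>\<mu> :: complex. \<mu> \<noteq> 0 \<Longrightarrow> \<mu> ^ e * f (1 / \<mu> ^ w) = h \<mu>"
  shows "\<exists>q. degree q \<le> e \<and> (\<forall>t. f t = poly q t)"
proof -
  \<comment> \<open>The region where \<open>t\<close> has norm at least 1 corresponds to the
    punctured closed unit disc in \<open>\<mu>\<close>.\<close>
  have "compact (h ` cball 0 1)"
    by (intro compact_continuous_image continuous_on_subset[OF h]) auto
  then obtain B where B: "\<And>\<mu>. norm \<mu> \<le> 1 \<Longrightarrow> norm (h \<mu>) \<le> B"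
    using compact_imp_bounded by (force simp: bounded_iff)
  have "norm (f t) \<le> B * norm t ^ e" if t: "1 \<le> norm t" for t
  proof -
    have "1 / t \<noteq> 0" using t by auto
    then obtain \<mu> where \<mu>: "\<mu> \<noteq> 0" "1 / t = \<mu> ^ w"
      using exists_complex_root_nonzero[of "1 / t" w] w by auto
    have t\<mu>: "t = 1 / \<mu> ^ w" using \<mu> by (simp flip: \<mu>(2))
    have "norm (\<mu> ^ w) \<le> 1" using t by (simp add: norm_divide divide_simps flip: \<mu>(2))
    then have \<mu>1: "norm \<mu> \<le> 1"
      using w by (metis norm_power power_le_one_iff norm_ge_zero not_less0)
    \<comment> \<open>This crude estimate bounds the inverse norm of \<open>\<mu>\<close> by the
      norm of \<open>t\<close>, giving growth of order \<open>e\<close>, which is all that is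
      claimed.\<close>
    have "norm \<mu> ^ w \<le> norm \<mu>"
      using power_decreasing[of 1 w "norm \<mu>"] w \<mu>1 by simp
    then have "1 / norm \<mu> \<le> norm t"
      using \<mu> w by (simp add: t\<mu> norm_divide norm_power frac_le)
    then have "(1 / norm \<mu>) ^ e \<le> norm t ^ e"
      by (intro power_mono) auto
    moreover have "norm (f t) = norm (h \<mu>) * (1 / norm \<mu>) ^ e"
      using fh[OF \<mu>(1), symmetric] \<mu>(1) by (simp add: t\<mu> norm_mult norm_power field_simps)
    moreover have "norm (h \<mu>) \<le> B" "0 \<le> B" using B[OF \<mu>1] norm_ge_zero[of "h \<mu>"] by linarith+
    ultimately show ?thesis by (simp add: mult_mono)
  qed
  then have "f t = (\<Sum>k\<le>e. (deriv ^^ k) f 0 / fact k * t ^ k)" for t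
    by (rule Liouville_polynomial[OF f])
  then show ?thesis
    by (intro exI[of _ "\<Sum>k\<le>e. monom ((deriv ^^ k) f 0 / fact k) k"])
      (auto simp: poly_sum poly_monom intro!: degree_sum_le degree_monom_le[THEN order.trans])
qed

section \<open>Holomorphic dependence on a parameter\<close>

text \<open>In the chain rule, the complex homogeneity of \<open>D\<close> turns the derivative of
  the composite into multiplication by a complex number.\<close>

lemma holomorphic_mv_compose:
  assumes h: "holomorphic_mv h UNIV" and \<zeta>: "\<And>j. (\<lambda>t. \<zeta> t $ j) holomorphic_on S" and S: "open S"
  shows "(\<lambda>t. h (\<zeta> t)) holomorphic_on S"
  unfolding holomorphic_on_open[OF S]
proof
  fix t assume t: "t \<in> S"
  then have "\<forall>j. \<exists>d. ((\<lambda>t. \<zeta> t $ j) has_field_derivative d) (at t)"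
    using \<zeta> S holomorphic_on_open by blast
  then obtain d where d: "\<And>j. ((\<lambda>t. \<zeta> t $ j) has_field_derivative d j) (at t)" by metis
  have \<zeta>d: "(\<zeta> has_derivative (\<lambda>c. c *s (\<chi> j. d j))) (at t)"
    unfolding has_derivative_componentwise_within[of \<zeta>]
  proof
    fix b :: "(complex, 'a) vec" assume "b \<in> Basis"
    then obtain j u where b: "b = axis j u" by (auto simp: Basis_vec_def)
    have "((\<lambda>t. \<zeta> t $ j) has_derivative (\<lambda>c. d j * c)) (at t)"
      using d[of j] by (simp add: has_field_derivative_def)
    from has_derivative_inner_left[OF this, of u]
    show "((\<lambda>x. \<zeta> x \<bullet> b) has_derivative (\<lambda>x. (x *s (\<chi> j. d j)) \<bullet> b)) (at t)"
      by (simp add: b inner_axis mult.commute)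
  qed
  obtain D where D: "(h has_derivative D) (at (\<zeta> t))" "\<And>c w. D (c *s w) = c * D w"
    using h unfolding holomorphic_mv_def by blast
  have "((\<lambda>t. h (\<zeta> t)) has_derivative (\<lambda>c. D (c *s (\<chi> j. d j)))) (at t)"
    using has_derivative_compose[OF \<zeta>d D(1)] .
  then show "\<exists>f'. ((\<lambda>t. h (\<zeta> t)) has_field_derivative f') (at t)"
    by (auto simp: has_field_derivative_def D(2) mult.commute[of _ "D _"]
        intro!: exI[of _ "D (\<chi> j. d j)"])
qed

lemma holomorphic_fps_mult:
  assumes "\<And>m. (\<lambda>t. fps_nth (u t) m) holomorphic_on S" "\<And>m. (\<lambda>t. fps_nth (v t) m) holomorphic_on S"
  shows "(\<lambda>t. fps_nth (u t * v t) m) holomorphic_on S"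
  unfolding fps_mult_nth by (intro holomorphic_intros assms)

text \<open>The coefficients of the inverse satisfy a recursion whose only division is by the
  nonvanishing constant term.\<close>

lemma holomorphic_fps_inverse:
  fixes u :: "complex \<Rightarrow> complex fps"
  assumes u: "\<And>m. (\<lambda>t. fps_nth (u t) m) holomorphic_on S" and u0: "\<And>t. t \<in> S \<Longrightarrow> fps_nth (u t) 0 \<noteq> 0"
  shows "(\<lambda>t. fps_nth (inverse (u t)) m) holomorphic_on S"
proof (induction m rule: less_induct)
  case (less m)
  show ?case
  proof (cases "m = 0")
    case True
    then show ?thesis using u[of 0] u0 by (auto intro!: holomorphic_intros)
  next
    case False
    have "fps_nth (inverse (u t)) m =
        - (\<Sum>i=1..m. fps_nth (u t) i * fps_nth (inverse (u t)) (m - i)) / fps_nth (u t) 0"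
      if "t \<in> S" for t
    proof -
      have "fps_nth (u t * inverse (u t)) m = 0"
        using inverse_mult_eq_1'[OF u0[OF that]] False by simp
      then have "fps_nth (u t) 0 * fps_nth (inverse (u t)) m +
          (\<Sum>i=1..m. fps_nth (u t) i * fps_nth (inverse (u t)) (m - i)) = 0"
        by (simp add: fps_mult_nth sum.atLeast_Suc_atMost)
      then show ?thesis using u0[OF that] by (simp add: field_simps eq_neg_iff_add_eq_0)
    qed
    moreover have "(\<lambda>t. - (\<Sum>i=1..m. fps_nth (u t) i * fps_nth (inverse (u t)) (m - i)) /
        fps_nth (u t) 0) holomorphic_on S"
      by (intro holomorphic_intros u u0 less.IH) (auto simp: False)
    ultimately show ?thesis by (simp cong: holomorphic_cong)
  qed
qed

text \<open>Positive weights bound every exponent by \<open>n\<close>.\<close>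

lemma finite_monomials_of_weight:
  assumes "finite V" "\<And>v. v \<in> V \<Longrightarrow> \<omega> v > 0"
  shows "finite {m. Poly_Mapping.keys m \<subseteq> V \<and> mon_weight \<omega> m = n}"
proof (rule inj_on_finite)
  show "inj_on Poly_Mapping.lookup {m. Poly_Mapping.keys m \<subseteq> V \<and> mon_weight \<omega> m = n}"
    by (auto simp: inj_on_def intro: poly_mapping_eqI)
  show "Poly_Mapping.lookup ` {m. Poly_Mapping.keys m \<subseteq> V \<and> mon_weight \<omega> m = n} \<subseteq>
      {f. \<forall>v. (v \<in> V \<longrightarrow> f v \<in> {..n}) \<and> (v \<notin> V \<longrightarrow> f v = 0)}"
  proof safe
    fix m v assume m: "Poly_Mapping.keys m \<subseteq> V" "n = mon_weight \<omega> m"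
    show "Poly_Mapping.lookup m v \<le> mon_weight \<omega> m" if "v \<in> V"
    proof (cases "v \<in> Poly_Mapping.keys m")
      case True
      have "Poly_Mapping.lookup m v \<le> \<omega> v * Poly_Mapping.lookup m v" using assms(2)[OF that] by simp
      also have "\<dots> \<le> mon_weight \<omega> m"
        unfolding mon_weight_def by (rule member_le_sum[OF True]) auto
      finally show ?thesis .
    qed (simp add: in_keys_iff)
    show "Poly_Mapping.lookup m v = 0" if "v \<notin> V"
      using m that by (auto simp: in_keys_iff)
  qed
  show "finite {f. \<forall>v. (v \<in> V \<longrightarrow> f v \<in> {..n}) \<and> (v \<notin> V \<longrightarrow> f v = 0)}"
    by (rule finite_set_of_finite_funs) (use assms in auto)
qed

section \<open>The polynomial defined by a section\<close>

text \<open>A polynomial lift with prescribed derivatives up to order \<open>k\<close> at the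
  origin; it realizes arbitrary coordinates \<open>x\<close>.\<close>

definition poly_curve :: "nat \<Rightarrow> ('i \<times> nat \<Rightarrow> complex) \<Rightarrow> complex \<Rightarrow> (complex, 'i::finite) vec" where
  "poly_curve k x z = (\<chi> i. \<Sum>m\<le>k. x (i, m) / fact m * z ^ m)"

definition base_pt :: "('i \<times> nat \<Rightarrow> complex) \<Rightarrow> (complex, 'i::finite) vec" where
  "base_pt x = (\<chi> i. x (i, 0))"

lemma base_pt_nth [simp]: "base_pt x $ i = x (i, 0)"
  by (simp add: base_pt_def)

lemma base_pt_nonzero: "base_pt x \<noteq> 0 \<longleftrightarrow> (\<exists>i. x (i, 0) \<noteq> 0)"
  by (auto simp: vec_eq_iff)

lemma poly_curve_0 [simp]: "poly_curve k x 0 = base_pt x"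
proof -
  have "(\<Sum>m\<le>k. x (i, m) / fact m * 0 ^ m) = x (i, 0)" for i
    by (subst sum.remove[of _ 0]) (auto simp: power_0_left intro!: sum.neutral)
  then show ?thesis by (simp add: poly_curve_def vec_eq_iff)
qed

lemma fps_expansion_truncated:
  fixes c :: "nat \<Rightarrow> complex"
  shows "(\<lambda>z. \<Sum>m\<le>k. c m * z ^ m) has_fps_expansion Abs_fps (\<lambda>m. if m \<le> k then c m else 0)"
proof (rule has_fps_expansion_schematicI)
  show "(\<lambda>z. \<Sum>m\<le>k. c m * z ^ m) has_fps_expansion (\<Sum>m\<le>k. fps_const (c m) * fps_X ^ m)"
    by (intro fps_expansion_intros)
  show "(\<Sum>m\<le>k. fps_const (c m) * fps_X ^ m) = Abs_fps (\<lambda>m. if m \<le> k then c m else 0)"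
    by (rule fps_ext) (simp add: fps_sum_nth if_distrib[of "\<lambda>y. _ * y"] cong: if_cong)
qed

lemma
  shows curve_holomorphic_poly_curve: "curve_holomorphic_at_0 (poly_curve k x)"
    and curve_fps_poly_curve:
      "curve_fps (poly_curve k x) i = Abs_fps (\<lambda>m. if m \<le> k then x (i, m) / fact m else 0)"
proof -
  have "(\<lambda>z. poly_curve k x z $ i) has_fps_expansion
      Abs_fps (\<lambda>m. if m \<le> k then x (i, m) / fact m else 0)" for i
    unfolding poly_curve_def vec_lambda_beta by (rule fps_expansion_truncated)
  then show "curve_holomorphic_at_0 (poly_curve k x)"
    "curve_fps (poly_curve k x) i = Abs_fps (\<lambda>m. if m \<le> k then x (i, m) / fact m else 0)"
    by (rule curve_holomorphicI, rule curve_fps_eqI)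
qed

text \<open>The derivatives of the affine coordinates of the projected curve, written as
  coefficients of quotients of power series so that their dependence on \<open>x\<close> is visibly
  holomorphic.\<close>

definition chart_coords :: "nat \<Rightarrow> 'n option \<Rightarrow> ('n::finite option \<times> nat \<Rightarrow> complex) \<Rightarrow> 'n \<times> nat \<Rightarrow> complex"
  where "chart_coords k a x = jet_coords (\<lambda>j. curve_fps (poly_curve k x) (omit a j) *
    inverse (curve_fps (poly_curve k x) a))"

lemma deriv_coord_chart_poly_curve:
  assumes "x (a, 0) \<noteq> 0"
  shows "deriv_coord (chart_map a \<circ> (proj_pt \<circ> poly_curve k x)) = chart_coords k a x"
proof -
  have "base_pt x \<noteq> 0" using assms base_pt_nonzero by blast
  then have "curve_fps (chart_map a \<circ> (proj_pt \<circ> poly_curve k x)) =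
      (\<lambda>j. curve_fps (poly_curve k x) (omit a j) * inverse (curve_fps (poly_curve k x) a))"
    using assms
    by (simp add: fun_eq_iff curve_fps_chart_map lift_fps_proj_pt curve_holomorphic_poly_curve)
  then show ?thesis by (simp only: deriv_coord_eq chart_coords_def)
qed

lemma holomorphic_chart_coords:
  assumes x: "\<And>v. (\<lambda>t. x t v) holomorphic_on S" and a: "\<And>t. t \<in> S \<Longrightarrow> x t (a, 0) \<noteq> 0"
  shows "(\<lambda>t. chart_coords k a (x t) v) holomorphic_on S"
proof -
  have "(\<lambda>t. fps_nth (curve_fps (poly_curve k (x t)) i) m) holomorphic_on S" for i m
    by (cases "m \<le> k") (auto simp: curve_fps_poly_curve intro!: holomorphic_intros x)
  then have "(\<lambda>t. fps_nth (curve_fps (poly_curve k (x t)) (omit a j) *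
      inverse (curve_fps (poly_curve k (x t)) a)) m) holomorphic_on S" for j m
    using a by (intro holomorphic_fps_mult holomorphic_fps_inverse) auto
  then show ?thesis
    by (cases v) (auto simp: chart_coords_def intro!: holomorphic_intros)
qed

section \<open>The function of the derivatives of a lift that a section defines\<close>

locale GG_section =
  fixes k n d :: nat and s :: "'n::finite proj \<Rightarrow> 'n twisted"
  assumes s_mem: "s \<in> GG_sections k n d"
begin

lemma section_O_fiber: "s x J \<in> O_fiber d x"
  using s_mem by (simp add: GG_sections_def twisted_fiber_def)

lemma section_GG_fiber: "(\<lambda>J. s x J v) \<in> GG_fiber proj_atlas k n x"
  using s_mem by (simp add: GG_sections_def twisted_fiber_def)

lemma section_scale_vec: "v \<in> line_of x \<Longrightarrow> s x J (c *s v) = c ^ d * s x J v"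
  using section_O_fiber[of x J] by (simp add: O_fiber_def)

lemma section_scale_jet:
  "hol_germ proj_atlas \<gamma> \<Longrightarrow> c \<noteq> 0 \<Longrightarrow>
     s (\<gamma> 0) (jet proj_atlas k (\<lambda>z. \<gamma> (c * z))) v = c ^ n * s (\<gamma> 0) (jet proj_atlas k \<gamma>) v"
proof -
  assume \<gamma>: "hol_germ proj_atlas \<gamma>" and c: "c \<noteq> 0"
  have "jet proj_atlas k \<gamma> \<in> jets_at proj_atlas k (\<gamma> 0)"
    using \<gamma> by (auto simp: jets_at_def)
  moreover have "\<forall>J\<in>jets_at proj_atlas k (\<gamma> 0). \<forall>c. c \<noteq> 0 \<longrightarrow>
      s (\<gamma> 0) (jet_scale proj_atlas k c J) v = c ^ n * s (\<gamma> 0) J v"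
    using section_GG_fiber[of "\<gamma> 0" v] unfolding GG_fiber_def mem_Collect_eq by (elim conjE)
  ultimately show ?thesis using c by (simp flip: jet_scale_jet[OF \<gamma>])
qed

text \<open>It has a geometric meaning only where \<open>base_pt x\<close> is nonzero.\<close>

definition F :: "('n option \<times> nat \<Rightarrow> complex) \<Rightarrow> complex" where
  "F x = s (proj_pt (base_pt x)) (jet proj_atlas k (proj_pt \<circ> poly_curve k x)) (base_pt x)"

lemma F_curve:
  assumes g: "curve_holomorphic_at_0 g" "g 0 \<noteq> 0"
  shows "s (proj_pt (g 0)) (jet proj_atlas k (proj_pt \<circ> g)) (g 0) = F (deriv_coord g)"
proof -
  have "base_pt (deriv_coord g) = g 0"
    by (simp add: vec_eq_iff deriv_coord_eq)
  moreover have "jet proj_atlas k (proj_pt \<circ> g) =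
      jet proj_atlas k (proj_pt \<circ> poly_curve k (deriv_coord g))"
    using g by (intro jet_proj_pt_cong curve_holomorphic_poly_curve)
      (auto simp: fps_agree_def curve_fps_poly_curve deriv_coord_eq)
  ultimately show ?thesis by (simp add: F_def)
qed

lemma F_cong:
  assumes "\<And>i m. m \<le> k \<Longrightarrow> x (i, m) = y (i, m)"
  shows "F x = F y"
proof -
  have "poly_curve k x = poly_curve k y"
    using assms by (auto simp: poly_curve_def fun_eq_iff vec_eq_iff)
  moreover from this have "base_pt x = base_pt y"
    using assms by (simp add: vec_eq_iff)
  ultimately show ?thesis by (simp add: F_def)
qed

lemma F_rescale:
  assumes "c \<noteq> 0" "base_pt x \<noteq> 0"
  shows "F (\<lambda>v. c ^ snd v * x v) = c ^ n * F x"
proof -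
  have b: "base_pt (\<lambda>v. c ^ snd v * x v) = base_pt x"
    by (simp add: vec_eq_iff)
  have "(proj_pt \<circ> poly_curve k (\<lambda>v. c ^ snd v * x v)) = (\<lambda>z. (proj_pt \<circ> poly_curve k x) (c * z))"
    by (auto simp: poly_curve_def power_mult_distrib mult_ac)
  moreover have germ: "hol_germ proj_atlas (proj_pt \<circ> poly_curve k x)"
    using assms by (intro hol_germ_proj_pt curve_holomorphic_poly_curve) simp
  ultimately show ?thesis
    using section_scale_jet[OF germ assms(1), of "base_pt x"]
    unfolding F_def b by (simp only: o_apply poly_curve_0)
qed

text \<open>Multiplying a lift by a unit function changes neither the projected curve nor its jet,
  only the vector at the origin, on which the section is homogeneous of degree
  \<open>d\<close>.\<close>

lemma F_mult:
  assumes q: "fps_nth q 0 \<noteq> 0" and x: "base_pt (jet_coords u) \<noteq> 0"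
  shows "F (jet_coords (\<lambda>i. q * u i)) = fps_nth q 0 ^ d * F (jet_coords u)"
proof -
  define g where "g = poly_curve k (jet_coords u)"
  \<comment> \<open>The series \<open>q\<close> is merely formal and need not converge; its
    truncation is an honest function, and \<open>F\<close> sees only orders up to
    \<open>k\<close>.\<close>
  define c where "c z = (\<Sum>m\<le>k. fps_nth q m * z ^ m)" for z
  define C where "C = Abs_fps (\<lambda>m. if m \<le> k then fps_nth q m else 0)"
  define h where "h z = c z *s g z" for z
  have C: "c has_fps_expansion C"
    using fps_expansion_truncated[where c = "fps_nth q"] by (simp add: c_def[abs_def] C_def)
  then have c0: "c 0 = fps_nth q 0"
    using has_fps_expansion_imp_0_eq_fps_nth_0[OF C] by (simp add: C_def)
  have g: "curve_holomorphic_at_0 g" "g 0 = base_pt (jet_coords u)"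
    by (simp_all add: g_def curve_holomorphic_poly_curve)
  have hfps: "(\<lambda>z. h z $ i) has_fps_expansion C * curve_fps g i" for i
    unfolding h_def vector_smult_component
    by (intro fps_expansion_intros C curve_has_fps_expansion g)
  then have h: "curve_holomorphic_at_0 h" by (rule curve_holomorphicI)
  have h0: "h 0 = fps_nth q 0 *s base_pt (jet_coords u)" by (simp add: h_def c0 g)
  have "h 0 \<noteq> 0" using q x by (simp add: h0)
  have "((\<lambda>z. c z) \<longlongrightarrow> c 0) (nhds 0)"
    using has_fps_expansion_imp_continuous[OF C, of UNIV] by (simp add: isCont_def tendsto_nhds_iff)
  then have "\<forall>\<^sub>F z in nhds 0. c z \<noteq> 0"
    by (rule tendsto_imp_eventually_ne) (simp add: c0 q)
  then have "\<forall>\<^sub>F z in nhds 0. (proj_pt \<circ> h) z = (proj_pt \<circ> g) z"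
    by eventually_elim (simp add: h_def proj_pt_scale)
  then have "jet proj_atlas k (proj_pt \<circ> h) = jet proj_atlas k (proj_pt \<circ> g)"
    by (intro jet_cong hol_germ_proj_pt g h) (use x g \<open>h 0 \<noteq> 0\<close> in auto)
  then have "F (deriv_coord h) = fps_nth q 0 ^ d * F (jet_coords u)"
    using F_curve[OF h \<open>h 0 \<noteq> 0\<close>] q x
    by (simp add: h0 proj_pt_scale section_scale_vec in_line_of_proj_pt F_def g_def)
  moreover have "F (deriv_coord h) = F (jet_coords (\<lambda>i. q * u i))"
  proof (rule F_cong)
    fix i m assume m: "m \<le> k"
    have "fps_agree k (C * curve_fps g i) (q * u i)"
      by (intro fps_agree_mult) (simp_all add: fps_agree_def C_def g_def curve_fps_poly_curve)
    then show "deriv_coord h (i, m) = jet_coords (\<lambda>i. q * u i) (i, m)"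
      using m by (simp add: deriv_coord_eq curve_fps_eqI[OF hfps] fps_agree_def)
  qed
  ultimately show ?thesis by simp
qed

lemma F_scale:
  assumes "c \<noteq> 0" "base_pt x \<noteq> 0"
  shows "F (\<lambda>v. c * x v) = c ^ d * F x"
proof -
  obtain u where u: "jet_coords u = x" using jet_coords_surj by metis
  then have "(\<lambda>v. c * x v) = jet_coords (\<lambda>i. fps_const c * u i)"
    by (auto simp: jet_coords_def fun_eq_iff)
  then show ?thesis using F_mult[of "fps_const c" u] assms u by simp
qed

definition is_frame :: "'n option \<Rightarrow> ('n proj \<Rightarrow> ('n \<times> nat) cpoly) \<Rightarrow> bool" where
  "is_frame a p \<longleftrightarrow> (\<forall>x\<in>chart_dom a. cpoly_vars (p x) \<subseteq> UNIV \<times> {1..k} \<and>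
       (\<forall>\<gamma>. hol_germ proj_atlas \<gamma> \<and> \<gamma> 0 = x \<longrightarrow>
          (\<forall>v\<in>line_of x. s x (jet proj_atlas k \<gamma>) v =
             cpoly_eval (deriv_coord (chart_map a \<circ> \<gamma>)) (p x) * (v $ a) ^ d))) \<and>
    (\<forall>m. holomorphic_mv
       (\<lambda>z. Poly_Mapping.lookup (p (inv_into (chart_dom a) (chart_map a) z)) m)
       (chart_map a ` chart_dom a))"

definition frame :: "'n option \<Rightarrow> 'n proj \<Rightarrow> ('n \<times> nat) cpoly" where
  "frame a = (SOME p. is_frame a p)"

lemma is_frame: "is_frame a (frame a)"
proof -
  have "\<forall>a. \<exists>p. is_frame a p"
    using s_mem unfolding GG_sections_def is_frame_def mem_Collect_eq by (rule conjunct2)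
  then have "\<exists>p. is_frame a p" by (rule spec)
  then show ?thesis unfolding frame_def by (rule someI_ex)
qed

lemma frame_eq:
  assumes "\<gamma> 0 \<in> chart_dom a" "hol_germ proj_atlas \<gamma>" "v \<in> line_of (\<gamma> 0)"
  shows "s (\<gamma> 0) (jet proj_atlas k \<gamma>) v =
    cpoly_eval (deriv_coord (chart_map a \<circ> \<gamma>)) (frame a (\<gamma> 0)) * (v $ a) ^ d"
proof -
  have "\<forall>\<gamma>'. hol_germ proj_atlas \<gamma>' \<and> \<gamma>' 0 = \<gamma> 0 \<longrightarrow>
      (\<forall>v\<in>line_of (\<gamma> 0). s (\<gamma> 0) (jet proj_atlas k \<gamma>') v =
        cpoly_eval (deriv_coord (chart_map a \<circ> \<gamma>')) (frame a (\<gamma> 0)) * (v $ a) ^ d)"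
    by (rule conjunct2[OF bspec[OF conjunct1[OF is_frame[unfolded is_frame_def]] assms(1)]])
  from spec[OF this, of \<gamma>] show ?thesis using assms by simp
qed

lemma F_chart:
  assumes "x (a, 0) \<noteq> 0"
  shows "F x = cpoly_eval (chart_coords k a x) (frame a (proj_pt (base_pt x))) * x (a, 0) ^ d"
proof -
  have x: "base_pt x \<noteq> 0" using assms base_pt_nonzero by blast
  have dom: "proj_pt (base_pt x) \<in> chart_dom a"
    using assms x by (simp add: proj_pt_in_chart_dom)
  have germ: "hol_germ proj_atlas (proj_pt \<circ> poly_curve k x)"
    by (rule hol_germ_proj_pt) (simp_all add: curve_holomorphic_poly_curve x)
  have "F x = cpoly_eval (deriv_coord (chart_map a \<circ> (proj_pt \<circ> poly_curve k x)))
      (frame a (proj_pt (base_pt x))) * (base_pt x $ a) ^ d"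
    using frame_eq[OF _ germ, of a "base_pt x"] dom in_line_of_proj_pt[OF x] by (simp add: F_def)
  then show ?thesis by (simp only: deriv_coord_chart_poly_curve[of x, OF assms] base_pt_nth)
qed

definition monomials :: "('n \<times> nat \<Rightarrow>\<^sub>0 nat) set" where
  "monomials = {m. Poly_Mapping.keys m \<subseteq> UNIV \<times> {1..k} \<and> mon_weight snd m = n}"

lemma finite_monomials: "finite monomials"
  unfolding monomials_def by (rule finite_monomials_of_weight) auto

text \<open>The coefficient polynomials of a section carry no explicit degree bound. Weight
  homogeneity of \<open>F\<close> forces their monomials to have weight \<open>n\<close>, hence to
  lie in a finite set independent of the point.\<close>

lemma keys_frame:
  assumes y: "y \<in> chart_dom a"
  shows "Poly_Mapping.keys (frame a y) \<subseteq> monomials"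
proof
  fix m assume m: "m \<in> Poly_Mapping.keys (frame a y)"
  have vars: "cpoly_vars (frame a y) \<subseteq> UNIV \<times> {1..k}"
    using is_frame[of a] y by (simp add: is_frame_def)
  \<comment> \<open>The derivatives of a lift over \<open>y\<close> with \<open>a\<close>-th
    coordinate constantly 1 and chart coordinates \<open>w\<close>; along it \<open>F\<close> equals
    the local polynomial at \<open>w\<close>.\<close>
  define X where "X w = (\<lambda>(i, m). if m = 0 then normalized a y $ i
    else if i = a then 0 else w (inv (omit a) i, m))" for w :: "'n \<times> nat \<Rightarrow> complex"
  have b: "base_pt (X w) = normalized a y" for w
    by (simp add: vec_eq_iff X_def)
  have 1: "X w (a, 0) = 1" for w
    by (simp add: X_def normalized_nth_self[OF y])
  have "curve_fps (poly_curve k (X w)) a = 1" for w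
    by (rule fps_ext) (auto simp: curve_fps_poly_curve X_def normalized_nth_self[OF y])
  then have coords: "chart_coords k a (X w) (j, i) = w (j, i)" if "i \<in> {1..k}" for w i j
    using that by (simp add: chart_coords_def curve_fps_poly_curve X_def inv_f_f[OF inj_omit])
  have FX: "F (X w) = cpoly_eval w (frame a y)" for w
  proof -
    have "cpoly_eval (chart_coords k a (X w)) (frame a y) = cpoly_eval w (frame a y)"
      by (rule cpoly_eval_cong) (use vars coords in auto)
    then show ?thesis
      using F_chart[of "X w" a] 1[of w] by (simp add: b proj_pt_normalized[OF y])
  qed
  have "cpoly_eval (\<lambda>v. c ^ snd v * w v) (frame a y) = c ^ n * cpoly_eval w (frame a y)"
    if "c \<noteq> 0" for w c
  proof -
    have "X (\<lambda>v. c ^ snd v * w v) = (\<lambda>v. c ^ snd v * X w v)"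
      by (auto simp: X_def fun_eq_iff)
    then show ?thesis
      using F_rescale[OF that, of "X w"] by (simp add: b normalized_nonzero[OF y] flip: FX)
  qed
  from weight_homogeneous_keys(2)[OF this m] have "mon_weight snd m = n" .
  then show "m \<in> monomials"
    using m vars by (auto simp: monomials_def cpoly_vars_def)
qed

text \<open>The sets where a given homogeneous coordinate is nonzero form an open cover of
  \<open>S\<close>. On each, \<open>F\<close> is a finite sum of holomorphic coefficients times
  monomials in the chart coordinates.\<close>

lemma F_holomorphic:
  assumes x: "\<And>v. (\<lambda>t. x t v) holomorphic_on S" and S: "open S"
    and nz: "\<And>t. t \<in> S \<Longrightarrow> base_pt (x t) \<noteq> 0"
  shows "(\<lambda>t. F (x t)) holomorphic_on S"
proof -
  define U where "U a = {t \<in> S. x t (a, 0) \<noteq> 0}" for a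
  have U: "open (U a)" for a
  proof -
    have "open (S \<inter> (\<lambda>t. x t (a, 0)) -` (- {0}))"
      by (intro continuous_open_preimage holomorphic_on_imp_continuous_on x S) auto
    moreover have "S \<inter> (\<lambda>t. x t (a, 0)) -` (- {0}) = U a" by (auto simp: U_def)
    ultimately show ?thesis by simp
  qed
  have xU: "(\<lambda>t. x t v) holomorphic_on U a" for a v
    by (rule holomorphic_on_subset[OF x]) (auto simp: U_def)
  define h where "h a m z = Poly_Mapping.lookup (frame a (inv_into (chart_dom a) (chart_map a) z)) m"
    for a m z
  have h: "holomorphic_mv (h a m) UNIV" for a m
    using is_frame[of a] by (simp add: is_frame_def chart_map_image h_def[abs_def])
  \<comment> \<open>The affine coordinates of the base point in chart \<open>a\<close>.\<close>
  define \<zeta> where "\<zeta> a t = (\<chi> j. x t (omit a j, 0) / x t (a, 0))" for a t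
  have \<zeta>: "(\<lambda>t. \<zeta> a t $ j) holomorphic_on U a" for a j
    unfolding \<zeta>_def vec_lambda_beta by (intro holomorphic_on_divide xU) (auto simp: U_def)
  have "(\<lambda>t. h a m (\<zeta> a t)) holomorphic_on U a" for a m
    by (rule holomorphic_mv_compose[OF h \<zeta> U])
  moreover have "(\<lambda>t. mon_eval (chart_coords k a (x t)) m) holomorphic_on U a" for a m
    by (rule holomorphic_on_mon_eval, rule holomorphic_chart_coords[OF xU]) (simp add: U_def)
  ultimately have f: "(\<lambda>t. (\<Sum>m\<in>monomials. h a m (\<zeta> a t) * mon_eval (chart_coords k a (x t)) m) *
      x t (a, 0) ^ d) holomorphic_on U a" (is "?f a holomorphic_on _") for a
    by (intro holomorphic_on_mult holomorphic_on_sum holomorphic_on_power xU)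
  have "?f a t = F (x t)" if "t \<in> U a" for a t
  proof -
    have a: "x t (a, 0) \<noteq> 0" using that by (simp add: U_def)
    then have dom: "proj_pt (base_pt (x t)) \<in> chart_dom a"
      using that nz by (simp add: proj_pt_in_chart_dom U_def)
    have "chart_map a (proj_pt (base_pt (x t))) = \<zeta> a t"
      using a by (simp add: vec_eq_iff chart_map_nth normalized_proj_pt \<zeta>_def field_simps)
    then have "inv_into (chart_dom a) (chart_map a) (\<zeta> a t) = proj_pt (base_pt (x t))"
      using inv_into_f_f[OF inj_on_chart_map dom] by simp
    then show ?thesis
      using F_chart[of "x t" a] a cpoly_eval_superset[OF finite_monomials keys_frame[OF dom]]
      by (simp add: h_def)
  qed
  then have "(\<lambda>t. F (x t)) holomorphic_on U a" for a
    by (rule holomorphic_transform[OF f])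
  then have "(\<lambda>t. F (x t)) holomorphic_on (\<Union>a. U a)"
    by (intro holomorphic_on_UN_open U)
  moreover have "(\<Union>a. U a) = S" using nz by (auto simp: U_def base_pt_nonzero)
  ultimately show ?thesis by simp
qed

text \<open>For a variable of order 0 the growth bound comes from homogeneity of degree
  \<open>d\<close>; as \<open>\<mu>\<close> tends to 0 the base point survives because that variable
  is set to 1. For positive order it comes from weight homogeneity, which leaves the base point
  fixed.\<close>

lemma F_separately_polynomial:
  assumes nz: "\<And>t. base_pt (x(v := t)) \<noteq> 0"
  shows "\<exists>q. degree q \<le> n + d \<and> (\<forall>t. F (x(v := t)) = poly q t)"
proof -
  obtain i m where v: "v = (i, m)" by (cases v)
  have hol: "(\<lambda>t. F (x(v := t))) holomorphic_on UNIV"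
  proof (rule F_holomorphic)
    fix u show "(\<lambda>t. (x(v := t)) u) holomorphic_on UNIV"
      by (cases "u = v") auto
  qed (use nz in auto)
  \<comment> \<open>Weights \<open>w\<close> of the variables in which \<open>F\<close> is homogeneous of degree \<open>e\<close>, with \<open>w v > 0\<close>
    and such that the limit of the rescaled jet has a nonzero base point.\<close>
  have main: "\<exists>q. degree q \<le> n + d \<and> (\<forall>t. F (x(v := t)) = poly q t)"
    if w: "w v > 0" and e: "e \<le> n + d"
      and Fw: "\<And>c y. c \<noteq> 0 \<Longrightarrow> base_pt y \<noteq> 0 \<Longrightarrow> F (\<lambda>u. c ^ w u * y u) = c ^ e * F y"
      and nz': "\<And>\<mu>. base_pt ((\<lambda>u. \<mu> ^ w u * x u)(v := 1)) \<noteq> 0" for w e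
  proof -
    have "(\<lambda>\<mu>. F ((\<lambda>u. \<mu> ^ w u * x u)(v := 1))) holomorphic_on UNIV"
    proof (rule F_holomorphic)
      fix u show "(\<lambda>\<mu>. ((\<lambda>u. \<mu> ^ w u * x u)(v := 1)) u) holomorphic_on UNIV"
        by (cases "u = v") (auto intro!: holomorphic_intros)
    qed (use nz' in auto)
    moreover have "\<mu> ^ e * F (x(v := 1 / \<mu> ^ w v)) = F ((\<lambda>u. \<mu> ^ w u * x u)(v := 1))"
      if "\<mu> \<noteq> 0" for \<mu>
    proof -
      have "(\<lambda>u. \<mu> ^ w u * (x(v := 1 / \<mu> ^ w v)) u) = (\<lambda>u. \<mu> ^ w u * x u)(v := 1)"
        using that by (auto simp: fun_eq_iff)
      then show ?thesis using Fw[OF that nz, of "1 / \<mu> ^ w v"] by simp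
    qed
    ultimately obtain q where "degree q \<le> e" "\<And>t. F (x(v := t)) = poly q t"
      using entire_imp_polynomial[OF hol holomorphic_on_imp_continuous_on w] by blast
    then show ?thesis using e by (intro exI[of _ q]) auto
  qed
  show ?thesis
  proof (cases "m = 0")
    case True
    show ?thesis
    proof (rule main[of "\<lambda>_. 1" d])
      fix \<mu> show "base_pt ((\<lambda>u. \<mu> ^ 1 * x u)(v := 1)) \<noteq> 0"
        unfolding base_pt_nonzero by (rule exI[of _ i]) (simp add: v True)
    qed (use F_scale in auto)
  next
    case False
    show ?thesis
    proof (rule main[of snd n])
      fix \<mu>
      obtain i' where "x (i', 0) \<noteq> 0"
        using nz[of 0] False by (auto simp: base_pt_nonzero v split: if_splits)
      then show "base_pt ((\<lambda>u. \<mu> ^ snd u * x u)(v := 1)) \<noteq> 0"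
        unfolding base_pt_nonzero using False by (intro exI[of _ i']) (auto simp: v)
    qed (use F_rescale False v in auto)
  qed
qed

end

text \<open>Identities known only at nonzero base points or for unit series are extended to all
  arguments by perturbing with \<open>t\<close> and letting \<open>t\<close> tend to 0.\<close>

lemma tendsto_cpoly_eval_eq:
  assumes "\<And>v. ((\<lambda>t. x t v) \<longlongrightarrow> x' v) (at (0 :: complex))"
    "\<And>v. ((\<lambda>t. y t v) \<longlongrightarrow> y' v) (at 0)" "(c \<longlongrightarrow> c') (at 0)"
    and ev: "\<forall>\<^sub>F t in at 0. cpoly_eval (x t) P = c t * cpoly_eval (y t) Q"
  shows "cpoly_eval x' P = c' * cpoly_eval y' Q"
proof (rule tendsto_unique[OF at_neq_bot])
  show "((\<lambda>t. cpoly_eval (x t) P) \<longlongrightarrow> cpoly_eval x' P) (at 0)"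
    by (rule tendsto_cpoly_eval) (rule assms)
  have "((\<lambda>t. c t * cpoly_eval (y t) Q) \<longlongrightarrow> c' * cpoly_eval y' Q) (at 0)"
    by (intro tendsto_mult tendsto_cpoly_eval assms)
  then show "((\<lambda>t. cpoly_eval (x t) P) \<longlongrightarrow> c' * cpoly_eval y' Q) (at 0)"
    by (rule Lim_transform_eventually) (use ev in eventually_elim, simp)
qed

lemma eventually_shift_nonzero: "\<forall>\<^sub>F t in at 0. a + t \<noteq> (0 :: complex)"
  using eventually_neq_at_within[of "- a"]
  by (rule eventually_mono) (metis add_eq_0_iff)

context GG_section
begin

text \<open>Fixing the coordinate \<open>(b, 0)\<close> at a nonzero value keeps the base point
  nonzero for all values of the other variables, so each slice is a polynomial. Interpolating in
  \<open>(b, 0)\<close> needs the whole line in that direction, hence another nonzero base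
  coordinate; the remaining points are reached by continuity.\<close>

lemma F_polynomial:
  "\<exists>P. cpoly_vars P \<subseteq> UNIV \<times> {..k} \<and> (\<forall>x. base_pt x \<noteq> 0 \<longrightarrow> F x = cpoly_eval x P)"
proof -
  define b :: "'n option" where "b = None"
  \<comment> \<open>A second index exists since the type \<open>'n\<close> is nonempty, that is, N
    is at least 1.\<close>
  define a :: "'n option" where "a = Some undefined"
  have ab: "a \<noteq> b" by (simp add: a_def b_def)
  \<comment> \<open>One node more than the degree bound \<open>n + d\<close>, all of them
    nonzero.\<close>
  define A :: "complex set" where "A = of_nat ` {1..n + d + 1}"
  have A: "finite A" "card A = n + d + 1" "0 \<notin> A"
    unfolding A_def by (auto simp: card_image inj_on_def simp del: of_nat_Suc)
  have "\<exists>p. cpoly_vars p \<subseteq> UNIV \<times> {..k} - {(b, 0)} \<and>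
      (\<forall>x. F (x((b, 0) := c)) = cpoly_eval x p)" if c: "c \<noteq> 0" for c
  proof (rule separately_polynomial_imp_cpoly)
    fix v x assume v: "v \<in> UNIV \<times> {..k} - {(b, 0)}"
    have "\<exists>q. degree q \<le> n + d \<and> (\<forall>t. F ((x((b, 0) := c))(v := t)) = poly q t)"
    proof (rule F_separately_polynomial)
      fix t show "base_pt ((x((b, 0) := c))(v := t)) \<noteq> 0"
        unfolding base_pt_nonzero by (rule exI[of _ b]) (use v c in auto)
    qed
    moreover have "(x(v := t))((b, 0) := c) = (x((b, 0) := c))(v := t)" for t
      using v by (intro fun_upd_twist) auto
    ultimately show "\<exists>q. degree q \<le> n + d \<and> (\<forall>t. F ((x(v := t))((b, 0) := c)) = poly q t)"
      by simp
  next
    fix x y :: "'n option \<times> nat \<Rightarrow> complex"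
    assume "\<And>v. v \<in> UNIV \<times> {..k} - {(b, 0)} \<Longrightarrow> x v = y v"
    then show "F (x((b, 0) := c)) = F (y((b, 0) := c))"
      by (intro F_cong) auto
  qed simp
  then obtain p where p: "\<And>c. c \<noteq> 0 \<Longrightarrow> cpoly_vars (p c) \<subseteq> UNIV \<times> {..k} - {(b, 0)}"
    "\<And>c x. c \<noteq> 0 \<Longrightarrow> F (x((b, 0) := c)) = cpoly_eval x (p c)"
    by metis
  define P where "P = (\<Sum>c\<in>A. p c * lagrange_cpoly A (b, 0) c)"
  have "cpoly_vars P \<subseteq> UNIV \<times> {..k}"
    unfolding P_def
  proof (rule cpoly_vars_sum)
    fix c assume "c \<in> A"
    then have "cpoly_vars (p c) \<subseteq> UNIV \<times> {..k}" using p(1)[of c] A(3) by blast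
    then show "cpoly_vars (p c * lagrange_cpoly A (b, 0) c) \<subseteq> UNIV \<times> {..k}"
      using cpoly_vars_mult[of "p c" "lagrange_cpoly A (b, 0) c"] cpoly_vars_lagrange[of A "(b, 0)" c]
      by auto
  qed
  moreover have generic: "F x = cpoly_eval x P" if x: "x (i, 0) \<noteq> 0" "i \<noteq> b" for x i
  proof -
    have "\<exists>q. degree q \<le> n + d \<and> (\<forall>t. F (x((b, 0) := t)) = poly q t)"
    proof (rule F_separately_polynomial)
      fix t show "base_pt (x((b, 0) := t)) \<noteq> 0"
        unfolding base_pt_nonzero by (rule exI[of _ i]) (use x in auto)
    qed
    then obtain q where "degree q \<le> n + d" "\<And>t. F (x((b, 0) := t)) = poly q t" by blast
    moreover have "F (x((b, 0) := c)) = cpoly_eval x (p c)" if "c \<in> A" for c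
      by (rule p(2)) (use that A(3) in auto)
    ultimately show ?thesis
      unfolding P_def using A by (intro cpoly_interpolation[of A q F x "(b, 0)" p]) simp_all
  qed
  \<comment> \<open>Here all other base coordinates may vanish. Moving \<open>(a, 0)\<close>
    slightly reaches the case already settled, and along this line \<open>F\<close> is a polynomial,
    hence continuous.\<close>
  moreover have "F x = cpoly_eval x P" if x: "x (b, 0) \<noteq> 0" for x
  proof -
    have "\<exists>q. degree q \<le> n + d \<and> (\<forall>t. F (x((a, 0) := t)) = poly q t)"
    proof (rule F_separately_polynomial)
      fix t show "base_pt (x((a, 0) := t)) \<noteq> 0"
        unfolding base_pt_nonzero by (rule exI[of _ b]) (use x ab in auto)
    qed
    then obtain q where q: "\<And>t. F (x((a, 0) := t)) = poly q t" by blast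
    have lim: "((\<lambda>t. x (a, 0) + t) \<longlongrightarrow> x (a, 0)) (at 0)"
      using tendsto_add[OF tendsto_const tendsto_ident_at, of "x (a, 0)" 0] by simp
    \<comment> \<open>The factor \<open>cpoly_eval x 1\<close> is 1; it only gives the equation the
      shape required by \<open>tendsto_cpoly_eval_eq\<close>.\<close>
    have "cpoly_eval x P = poly q (x (a, 0)) * cpoly_eval x 1"
    proof (rule tendsto_cpoly_eval_eq)
      show "((\<lambda>t. (x((a, 0) := x (a, 0) + t)) v) \<longlongrightarrow> x v) (at 0)" for v
        using lim by (cases "v = (a, 0)") auto
      show "((\<lambda>t. poly q (x (a, 0) + t)) \<longlongrightarrow> poly q (x (a, 0))) (at 0)"
        using lim by (rule tendsto_poly)
      show "\<forall>\<^sub>F t in at 0. cpoly_eval (x((a, 0) := x (a, 0) + t)) P =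
          poly q (x (a, 0) + t) * cpoly_eval x 1"
        using eventually_shift_nonzero[of "x (a, 0)"]
        by (rule eventually_mono) (use generic[of _ a] ab in \<open>simp flip: q\<close>)
    qed simp
    then show ?thesis using q[of "x (a, 0)"] by simp
  qed
  ultimately show ?thesis unfolding base_pt_nonzero by metis
qed

lemma section_polynomial:
  "\<exists>P\<in>V_diff d k. weight_comp snd n P = P \<and> (\<forall>m\<in>Poly_Mapping.keys P. mon_weight snd m = n) \<and>
     (\<forall>x. base_pt x \<noteq> 0 \<longrightarrow> F x = cpoly_eval x P)"
proof -
  obtain P where P: "cpoly_vars P \<subseteq> UNIV \<times> {..k}" "\<And>x. base_pt x \<noteq> 0 \<Longrightarrow> F x = cpoly_eval x P"
    using F_polynomial by blast
  define i :: "'n option" where "i = None"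
  have "jet_homogeneous d P"
    unfolding jet_homogeneous_def
  proof (intro allI)
    fix q :: "complex fps" and u :: "'n option \<Rightarrow> complex fps"
    \<comment> \<open>Adding a small nonzero constant makes \<open>q\<close> a unit and, applied to
      \<open>u\<close>, the base point nonzero, so that \<open>F_mult\<close> applies before passing
      to the limit.\<close>
    define q' where "q' t = q + fps_const t" for t
    define u' where "u' t j = u j + fps_const t" for t j
    have lim: "((\<lambda>t. fps_nth (q' t) m) \<longlongrightarrow> fps_nth q m) (at 0)"
      "((\<lambda>t. fps_nth (u' t j) m) \<longlongrightarrow> fps_nth (u j) m) (at 0)" for m j
      by (cases "m = 0"; auto simp: q'_def u'_def intro!: tendsto_eq_intros)+
    show "cpoly_eval (jet_coords (\<lambda>i. q * u i)) P = fps_nth q 0 ^ d * cpoly_eval (jet_coords u) P"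
    proof (rule tendsto_cpoly_eval_eq)
      show "((\<lambda>t. jet_coords (\<lambda>i. q' t * u' t i) v) \<longlongrightarrow> jet_coords (\<lambda>i. q * u i) v) (at 0)" for v
        by (cases v) (auto simp: fps_mult_nth intro!: tendsto_intros lim)
      show "((\<lambda>t. jet_coords (u' t) v) \<longlongrightarrow> jet_coords u v) (at 0)" for v
        by (cases v) (auto intro!: tendsto_intros lim)
      show "((\<lambda>t. fps_nth (q' t) 0 ^ d) \<longlongrightarrow> fps_nth q 0 ^ d) (at 0)"
        by (intro tendsto_intros lim)
      show "\<forall>\<^sub>F t in at 0. cpoly_eval (jet_coords (\<lambda>i. q' t * u' t i)) P =
          fps_nth (q' t) 0 ^ d * cpoly_eval (jet_coords (u' t)) P"
        using eventually_shift_nonzero[of "fps_nth q 0"] eventually_shift_nonzero[of "fps_nth (u i) 0"]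
      proof eventually_elim
        case (elim t)
        have q0: "fps_nth (q' t) 0 \<noteq> 0" using elim by (simp add: q'_def)
        have u0: "base_pt (jet_coords (u' t)) \<noteq> 0"
          unfolding base_pt_nonzero by (rule exI[of _ i]) (use elim in \<open>simp add: u'_def\<close>)
        moreover have "base_pt (jet_coords (\<lambda>i. q' t * u' t i)) \<noteq> 0"
          using q0 u0 by (auto simp: base_pt_nonzero)
        ultimately show ?case using F_mult[OF q0 u0] P(2) by simp
      qed
    qed
  qed
  then have PV: "P \<in> V_diff d k" using P(1) by (simp add: V_diff_altdef)
  have hom: "cpoly_eval (\<lambda>v. c ^ snd v * x v) P = c ^ n * cpoly_eval x P" if c: "c \<noteq> 0" for c x
  proof (rule tendsto_cpoly_eval_eq[OF _ _ tendsto_const])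
    show x: "((\<lambda>t. x v + t) \<longlongrightarrow> x v) (at 0)" for v
      using tendsto_add[OF tendsto_const tendsto_ident_at, of "x v" 0] by simp
    show "((\<lambda>t. c ^ snd v * (x v + t)) \<longlongrightarrow> c ^ snd v * x v) (at 0)" for v
      by (intro tendsto_intros x)
    show "\<forall>\<^sub>F t in at 0. cpoly_eval (\<lambda>v. c ^ snd v * (x v + t)) P =
        c ^ n * cpoly_eval (\<lambda>v. x v + t) P"
      using eventually_shift_nonzero[of "x (i, 0)"]
    proof eventually_elim
      case (elim t)
      have x0: "base_pt (\<lambda>v. x v + t) \<noteq> 0"
        unfolding base_pt_nonzero by (rule exI[of _ i]) (use elim in simp)
      moreover have "base_pt (\<lambda>v. c ^ snd v * (x v + t)) \<noteq> 0"
        using x0 by (auto simp: base_pt_nonzero)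
      ultimately show ?case using F_rescale[OF c x0] P(2) by simp
    qed
  qed
  show ?thesis
    using PV P(2) weight_homogeneous_keys[OF hom] by blast
qed

end

text \<open>Constant \<open>q\<close> shows that every monomial of \<open>P\<close> has degree
  \<open>d\<close>, and each of its factors has order at most \<open>k\<close>. This bounds the
  weights that a global section can have.\<close>

lemma weight_le_degree:
  assumes P: "P \<in> V_diff d k" and m: "m \<in> Poly_Mapping.keys P"
  shows "mon_weight snd m \<le> k * d"
proof -
  have "cpoly_eval (\<lambda>v. c ^ 1 * x v) P = c ^ d * cpoly_eval x P" for c x
  proof -
    obtain u where u: "jet_coords u = x" using jet_coords_surj by metis
    then have "(\<lambda>v. c ^ 1 * x v) = jet_coords (\<lambda>i. fps_const c * u i)"
      by (auto simp: jet_coords_def fun_eq_iff)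
    then show ?thesis using P u by (auto simp: V_diff_altdef jet_homogeneous_def)
  qed
  from weight_homogeneous_keys(2)[OF this m] have d: "mon_weight (\<lambda>_. 1) m = d" .
  have "mon_weight snd m \<le> k * mon_weight (\<lambda>_. 1) m"
    unfolding mon_weight_def sum_distrib_left
  proof (rule sum_mono)
    fix v assume "v \<in> Poly_Mapping.keys m"
    then have "snd v \<le> k" using P m by (force simp: V_diff_altdef cpoly_vars_def)
    then show "snd v * Poly_Mapping.lookup m v \<le> k * (1 * Poly_Mapping.lookup m v)" by simp
  qed
  then show ?thesis by (simp only: d)
qed

text \<open>Every jet at \<open>x\<close> with a nonzero vector \<open>v\<close> of the line is the
  jet of a curve having a lift through \<open>v\<close>, namely a constant multiple of a normalized
  lift. Homogeneity settles \<open>v = 0\<close>, and both sides vanish elsewhere.\<close>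

lemma twisted_section_eqI:
  assumes s: "s \<in> GG_sections k n d" and P: "P \<in> V_diff d k"
    and eq: "\<And>g. curve_holomorphic_at_0 g \<Longrightarrow> g 0 \<noteq> 0 \<Longrightarrow>
      s (proj_pt (g 0)) (jet proj_atlas k (proj_pt \<circ> g)) (g 0) = cpoly_eval (deriv_coord g) P"
  shows "s = jet_section k d P"
proof (intro ext)
  fix x J v
  have O: "s x J \<in> O_fiber d x"
    using s by (simp add: GG_sections_def twisted_fiber_def)
  note O' = jet_section_O_fiber[OF P, of x J]
  have nonzero: "s x J v = jet_section k d P x J v"
    if J: "J \<in> jets_at proj_atlas k x" and v: "v \<in> line_of x" "v \<noteq> 0" for v
  proof -
    obtain \<gamma> where \<gamma>: "hol_germ proj_atlas \<gamma>" "\<gamma> 0 = x" "J = jet proj_atlas k \<gamma>"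
      using J by (rule jets_atE)
    obtain a where a: "x \<in> chart_dom a" using chart_dom_cover by blast
    have va: "v = v $ a *s normalized a x" using line_of_normalized v a by blast
    then have va0: "v $ a \<noteq> 0" using v(2) by auto
    define g where "g z = v $ a *s normalized a (\<gamma> z)" for z
    have "(\<lambda>z. g z $ i) has_fps_expansion fps_const (v $ a) * lift_fps a \<gamma> i" for i
      unfolding g_def vector_smult_component
      by (intro fps_expansion_intros lift_has_fps_expansion) (use \<gamma> a in auto)
    then have g: "curve_holomorphic_at_0 g" by (rule curve_holomorphicI)
    have g0: "g 0 = v" using va by (simp add: g_def \<gamma>)
    have "\<forall>\<^sub>F z in nhds 0. (proj_pt \<circ> g) z = \<gamma> z"
      using eventually_proj_pt_normalized[of \<gamma> a] \<gamma> a
      by (auto simp: g_def proj_pt_scale va0)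
    then have "jet proj_atlas k (proj_pt \<circ> g) = J"
      unfolding \<gamma>(3) by (intro jet_cong hol_germ_proj_pt g \<gamma>) (simp_all add: g0 v)
    then show ?thesis
      using eq[OF g] jet_section_curve[OF P g] g0 v by (simp add: proj_pt_in_line)
  qed
  show "s x J v = jet_section k d P x J v"
  proof (cases "J \<in> jets_at proj_atlas k x \<and> v \<in> line_of x")
    case True
    show ?thesis
    proof (cases "v = 0")
      case v: True
      obtain w where w: "w \<noteq> 0" "w \<in> line_of x"
        using proj_pt_exhaust in_line_of_proj_pt by metis
      \<comment> \<open>The factor is 1 for \<open>d = 0\<close> and 0 otherwise; in both cases the
        value at the origin is determined by that at \<open>w\<close>.\<close>
      have zero: "f v = 0 ^ d * f w" if "f \<in> O_fiber d x" for f
      proof -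
        have "f (0 *s w) = 0 ^ d * f w" using that w unfolding O_fiber_def by blast
        then show ?thesis by (simp add: v)
      qed
      show ?thesis using zero[OF O] zero[OF O'] nonzero[of w] w True by simp
    qed (use True nonzero in blast)
  next
    case False
    have "s x J v = 0"
    proof (cases "v \<in> line_of x")
      case True
      then show ?thesis
        using s False by (simp add: GG_sections_def twisted_fiber_def GG_fiber_def)
    qed (use O in \<open>simp add: O_fiber_def\<close>)
    then show ?thesis using False by (simp add: jet_section_eq_0)
  qed
qed

lemma weight_comp_sum: "weight_comp \<omega> n (sum f I) = (\<Sum>i\<in>I. weight_comp \<omega> n (f i))"
  by (induction I rule: infinite_finite_induct)
    (auto simp: weight_comp_add weight_comp_eq_0)

text \<open>Each weight contributes a polynomial \<open>P n\<close> homogeneous of weight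
  \<open>n\<close>. Those beyond \<open>k * d\<close> vanish, so their sum is a polynomial whose
  components are the \<open>P n\<close>.\<close>

lemma diff_section_surj:
  assumes "s \<in> H0_GG k d"
  shows "\<exists>P\<in>V_diff d k. diff_section k d P = s"
proof -
  have s: "s n \<in> GG_sections k n d" for n using assms by (simp add: H0_GG_def)
  have "\<exists>P\<in>V_diff d k. weight_comp snd n P = P \<and> (\<forall>m\<in>Poly_Mapping.keys P. mon_weight snd m = n) \<and>
      s n = jet_section k d P" for n
  proof -
    interpret GG_section k n d "s n" by unfold_locales (rule s)
    obtain P where P: "P \<in> V_diff d k" "weight_comp snd n P = P"
      "\<forall>m\<in>Poly_Mapping.keys P. mon_weight snd m = n" "\<And>x. base_pt x \<noteq> 0 \<Longrightarrow> F x = cpoly_eval x P"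
      using section_polynomial by blast
    have "s n = jet_section k d P"
    proof (rule twisted_section_eqI[OF s P(1)])
      fix g :: "complex \<Rightarrow> (complex, 'a option) vec"
      assume g: "curve_holomorphic_at_0 g" "g 0 \<noteq> 0"
      have "base_pt (deriv_coord g) = g 0" by (simp add: vec_eq_iff deriv_coord_eq)
      then show "s n (proj_pt (g 0)) (jet proj_atlas k (proj_pt \<circ> g)) (g 0) =
          cpoly_eval (deriv_coord g) P"
        using F_curve[OF g] P(4) g by simp
    qed
    with P show ?thesis by blast
  qed
  then obtain P where P: "\<And>n. P n \<in> V_diff d k" "\<And>n. weight_comp snd n (P n) = P n"
    "\<And>n m. m \<in> Poly_Mapping.keys (P n) \<Longrightarrow> mon_weight snd m = n"
    "\<And>n. s n = jet_section k d (P n)"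
    by metis
  have zero: "weight_comp snd n (P n') = 0" if "n \<noteq> n'" for n n'
    using that P(3) by (intro weight_comp_eq_0) auto
  have large: "P n = 0" if "n \<notin> {..k * d}" for n
    using that P(3)[of _ n] weight_le_degree[OF P(1), of _ n] by (metis keys_eq_empty ex_in_conv atMost_iff)
  define Q where "Q = (\<Sum>n\<le>k * d. P n)"
  have "weight_comp snd n Q = P n" for n
  proof -
    have "weight_comp snd n Q = (\<Sum>n'\<le>k * d. if n' = n then P n else 0)"
      unfolding Q_def weight_comp_sum by (intro sum.cong) (auto simp: P(2) zero)
    then show ?thesis using large[of n] by simp
  qed
  then have "diff_section k d Q = s"
    by (simp add: fun_eq_iff diff_section_def P(4))
  moreover have "Q \<in> V_diff d k" unfolding Q_def by (intro V_diff_sum P)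
  ultimately show ?thesis by blast
qed

lemma section_value_diff_section_curve:
  assumes "P \<in> V_diff d k" "curve_holomorphic_at_0 g" "g 0 \<noteq> 0"
  shows "section_value (diff_section k d P) (proj_pt (g 0)) (jet proj_atlas k (proj_pt \<circ> g)) (g 0) =
    cpoly_eval (deriv_coord g) P"
  by (simp add: section_value_diff_section jet_section_curve[OF assms])

text \<open>Evaluating the section along \<open>poly_curve k x\<close> recovers the value of the
  polynomial at every \<open>x\<close> with nonzero base point; continuity gives the remaining
  values.\<close>

lemma diff_section_inj: "inj_on (diff_section k d) (V_diff d k)"
proof (rule inj_onI)
  fix P Q :: "'n::finite option diffpoly"
  assume P: "P \<in> V_diff d k" and Q: "Q \<in> V_diff d k" and eq: "diff_section k d P = diff_section k d Q"
  have generic: "cpoly_eval x P = cpoly_eval x Q" if x: "base_pt x \<noteq> 0" for x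
  proof -
    let ?y = "deriv_coord (poly_curve k x)"
    have y: "cpoly_eval ?y R = cpoly_eval x R" if "R \<in> V_diff d k" for R
      using that by (intro cpoly_eval_cong)
        (auto simp: V_diff_altdef deriv_coord_eq curve_fps_poly_curve)
    have "cpoly_eval ?y P = cpoly_eval ?y Q"
      using section_value_diff_section_curve[OF P curve_holomorphic_poly_curve, of k x]
        section_value_diff_section_curve[OF Q curve_holomorphic_poly_curve, of k x] x eq by simp
    then show ?thesis by (simp add: y P Q)
  qed
  show "P = Q"
  proof (rule cpoly_eqI)
    fix x :: "'n option \<times> nat \<Rightarrow> complex"
    have x: "((\<lambda>t. x v + t) \<longlongrightarrow> x v) (at 0)" for v
      using tendsto_add[OF tendsto_const tendsto_ident_at, of "x v" 0] by simp
    have "cpoly_eval x P = 1 * cpoly_eval x Q"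
    proof (rule tendsto_cpoly_eval_eq[OF x x tendsto_const])
      show "\<forall>\<^sub>F t in at 0. cpoly_eval (\<lambda>v. x v + t) P = 1 * cpoly_eval (\<lambda>v. x v + t) Q"
        using eventually_shift_nonzero[of "x (None, 0)"]
        by (rule eventually_mono) (use generic in \<open>force simp: base_pt_nonzero\<close>)
    qed
    then show "cpoly_eval x P = cpoly_eval x Q" by simp
  qed
qed

section \<open>Linearity and the isomorphism\<close>

lemma diff_section_add: "diff_section k d (P + Q) = diff_section k d P + diff_section k d Q"
  by (simp add: fun_eq_iff diff_section_def weight_comp_add jet_section_add)

lemma diff_section_scale: "diff_section k d (cpoly_scale c P) = section_scale c (diff_section k d P)"
  by (simp add: fun_eq_iff diff_section_def weight_comp_scale jet_section_scale section_scale_def)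

lemma diff_section_image: "diff_section k d ` V_diff d k = H0_GG k d"
proof (intro equalityI subsetI)
  fix s assume "s \<in> H0_GG k d"
  then show "s \<in> diff_section k d ` V_diff d k" using diff_section_surj by blast
qed (use diff_section_H0 in auto)

lemma vector_space_section_scale: "vector_space section_scale"
  by unfold_locales (auto simp: section_scale_def fun_eq_iff algebra_simps)

theorem proposition3p2p1:
  fixes k d :: nat
  assumes "k \<ge> 1"
  shows "\<exists>\<Phi> :: 'n::finite option diffpoly \<Rightarrow> 'n graded_section.
    subspace_iso cpoly_scale (V_diff d k) section_scale (H0_GG k d) \<Phi> \<and>
    (\<forall>P\<in>V_diff d k. \<forall>g. curve_holomorphic_at_0 g \<and> g 0 \<noteq> 0 \<longrightarrow>
       section_value (\<Phi> P) (proj_pt (g 0)) (jet proj_atlas k (proj_pt \<circ> g)) (g 0)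
         = cpoly_eval (deriv_coord g) P)"
proof (intro exI conjI ballI allI impI)
  let ?V = "V_diff d k :: 'n option diffpoly set"
  interpret V: vector_space "cpoly_scale :: complex \<Rightarrow> 'n option diffpoly \<Rightarrow> 'n option diffpoly"
    by (rule vector_space_cpoly_scale)
  interpret H: vector_space "section_scale :: complex \<Rightarrow> 'n graded_section \<Rightarrow> 'n graded_section"
    by (rule vector_space_section_scale)
  have V: "V.subspace ?V"
    by (intro V.subspaceI V_diff_0 V_diff_add V_diff_scale)
  \<comment> \<open>The map is linear on all polynomials, so its image \<open>H0_GG k d\<close> of a
    subspace is again a subspace.\<close>
  have "module_hom cpoly_scale section_scale
      (diff_section k d :: 'n option diffpoly \<Rightarrow> 'n graded_section)"
    by (intro module_hom.intro module_hom_axioms.intro V.module_axioms H.module_axioms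
        diff_section_add diff_section_scale)
  from module_hom.subspace_image[OF this V]
  have "H.subspace (H0_GG k d :: 'n graded_section set)"
    by (simp only: diff_section_image)
  then show "subspace_iso cpoly_scale ?V section_scale (H0_GG k d) (diff_section k d)"
    unfolding subspace_iso_def bij_betw_def
    by (intro conjI ballI allI V H.vector_space_axioms V.vector_space_axioms diff_section_inj
        diff_section_image diff_section_add diff_section_scale)
qed (use section_value_diff_section_curve in blast)

end
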